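(* Let $\Gamma$ be a commutative group and $T=(T,u)$ a commutative ternary $\Gamma$-semiring. For each $P\in\mathrm{Spec}_\Gamma(T)$, the stalk $\mathcal{O}_{T,P}$ of the structure sheaf inherits a triadic bracket (for every $\gamma\in\Gamma$) from the triadic brackets $\{s_1,s_2,s_3\}_{\gamma,U}=s_1\cdot s_2\cdot s_3\cdot u_\gamma$ on the semirings of sections $\mathcal{O}_T(U)$, $U\ni P$ open, and the canonical localization map $T\to\mathcal{O}_{T,P}$ is a homomorphism of ternary $\Gamma$-semirings.
   Context: A commutative semiring is a tuple $(T,+,\cdot,0,1)$ with $(T,+,0)$ and $(T,\cdot,1)$ commutative monoids, multiplication distributing over addition, and $0\cdot x=x\cdot 0=0$. A commutative ternary $\Gamma$-semiring $(T,u)$ is a commutative semiring $T$ with a group homomorphism $u:\Gamma\to T^\times$, $\gamma\mapsto u_\gamma$, together with the operations $\{a\,b\,c\}_\gamma:=a b c u_\gamma$. A homomorphism $(T,u)\to(S,v)$ is a semiring homomorphism $\varphi$ with $\varphi(u_\gamma)=v_\gamma$ for all $\gamma\in\Gamma$. A $\Gamma$-ideal of $T$ is a subset $I$ which is a submonoid of $(T,+,0)$ and satisfies $\{a\,b\,c\}_\gamma\in I$ for all $a\in I$, $b,c\in T$, $\gamma\in\Gamma$. A proper $\Gamma$-ideal $P$ is prime if $\{a\,b\,c\}_\gamma\in P$ implies $a\in P$ or $b\in P$ or $c\in P$, for all $a,b,c\in T$, $\gamma\in\Gamma$. $\mathrm{Spec}_\Gamma(T)$ is the set of prime $\Gamma$-ideals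 with the topology whose closed sets are $V(I)=\{P\mid I\subseteq P\}$ for $\Gamma$-ideals $I$; the principal opens $D_\Gamma(f)=\{P\mid f\notin P\}$ form a basis. For $f\in T$, $T_f$ is the localization of the semiring $T$ at $S_f=\{1,f,f^2,\dots\}$: fractions $\frac as$ with $\frac as=\frac bt$ iff $wat=wbs$ for some $w\in S_f$, and the usual operations. The structure sheaf $\mathcal{O}_T$ is the unique sheaf of semirings on $\mathrm{Spec}_\Gamma(T)$ extending $\mathcal{O}_T(D_\Gamma(f))=T_f$, with restriction $T_f\to T_g$ for $D_\Gamma(g)\subseteq D_\Gamma(f)$ the unique semiring homomorphism compatible with the canonical maps from $T$. In the triadic bracket, multiplication is that of $\mathcal{O}_T(U)$ and $u_\gamma$ denotes the unit section it induces. *)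

theory Defs
  imports "HOL-Analysis.Abstract_Topology" "HOL-Algebra.Coset" "HOL-Algebra.Ring"
begin

locale comm_semiring = semiring R + comm_monoid R for R (structure)

text \<open>The library's \<^const>\<open>ring_hom\<close> does not mention zero, which has to be
  preserved explicitly when there are no additive inverses.\<close>

definition semiring_hom ::
    "('a, 'm) ring_scheme \<Rightarrow> ('b, 'n) ring_scheme \<Rightarrow> ('a \<Rightarrow> 'b) set" where
  "semiring_hom R S = {h \<in> ring_hom R S. h \<zero>\<^bsub>R\<^esub> = \<zero>\<^bsub>S\<^esub>}"

locale ternary_gamma_semiring = \<Gamma>: comm_group \<Gamma> + comm_semiring T
  for \<Gamma> :: "('g, 'k) monoid_scheme" (structure)
    and T :: "('a, 'm) ring_scheme" (structure)
    and u :: "'g \<Rightarrow> 'a" +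
  assumes u_hom: "u \<in> hom \<Gamma> (units_of T)"

definition tbracket ::
    "('a, 'm) ring_scheme \<Rightarrow> ('g \<Rightarrow> 'a) \<Rightarrow> 'g \<Rightarrow> 'a \<Rightarrow> 'a \<Rightarrow> 'a \<Rightarrow> 'a" where
  "tbracket T u \<gamma> a b c = a \<otimes>\<^bsub>T\<^esub> b \<otimes>\<^bsub>T\<^esub> c \<otimes>\<^bsub>T\<^esub> u \<gamma>"

definition ternary_hom ::
    "('g, 'k) monoid_scheme \<Rightarrow> ('a, 'm) ring_scheme \<Rightarrow> ('g \<Rightarrow> 'a) \<Rightarrow>
     ('b, 'n) ring_scheme \<Rightarrow> ('g \<Rightarrow> 'b) \<Rightarrow> ('a \<Rightarrow> 'b) set" where
  "ternary_hom \<Gamma> T u S v = {h \<in> semiring_hom T S. \<forall>\<gamma>\<in>carrier \<Gamma>. h (u \<gamma>) = v \<gamma>}"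

definition gamma_ideal ::
    "('g, 'k) monoid_scheme \<Rightarrow> ('a, 'm) ring_scheme \<Rightarrow> ('g \<Rightarrow> 'a) \<Rightarrow> 'a set \<Rightarrow> bool" where
  "gamma_ideal \<Gamma> T u I \<longleftrightarrow> submonoid I (add_monoid T) \<and>
     (\<forall>a\<in>I. \<forall>b\<in>carrier T. \<forall>c\<in>carrier T. \<forall>\<gamma>\<in>carrier \<Gamma>. tbracket T u \<gamma> a b c \<in> I)"

definition prime_gamma_ideal ::
    "('g, 'k) monoid_scheme \<Rightarrow> ('a, 'm) ring_scheme \<Rightarrow> ('g \<Rightarrow> 'a) \<Rightarrow> 'a set \<Rightarrow> bool" where
  "prime_gamma_ideal \<Gamma> T u P \<longleftrightarrow> gamma_ideal \<Gamma> T u P \<and> P \<noteq> carrier T \<and>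
     (\<forall>a\<in>carrier T. \<forall>b\<in>carrier T. \<forall>c\<in>carrier T. \<forall>\<gamma>\<in>carrier \<Gamma>.
        tbracket T u \<gamma> a b c \<in> P \<longrightarrow> a \<in> P \<or> b \<in> P \<or> c \<in> P)"

definition Spec ::
    "('g, 'k) monoid_scheme \<Rightarrow> ('a, 'm) ring_scheme \<Rightarrow> ('g \<Rightarrow> 'a) \<Rightarrow> 'a set set" where
  "Spec \<Gamma> T u = {P. prime_gamma_ideal \<Gamma> T u P}"

definition V_Spec ::
    "('g, 'k) monoid_scheme \<Rightarrow> ('a, 'm) ring_scheme \<Rightarrow> ('g \<Rightarrow> 'a) \<Rightarrow> 'a set \<Rightarrow> 'a set set" where
  "V_Spec \<Gamma> T u I = {P \<in> Spec \<Gamma> T u. I \<subseteq> P}"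

definition D_Spec ::
    "('g, 'k) monoid_scheme \<Rightarrow> ('a, 'm) ring_scheme \<Rightarrow> ('g \<Rightarrow> 'a) \<Rightarrow> 'a \<Rightarrow> 'a set set" where
  "D_Spec \<Gamma> T u f = {P \<in> Spec \<Gamma> T u. f \<notin> P}"

definition Spec_open ::
    "('g, 'k) monoid_scheme \<Rightarrow> ('a, 'm) ring_scheme \<Rightarrow> ('g \<Rightarrow> 'a) \<Rightarrow> 'a set set \<Rightarrow> bool" where
  "Spec_open \<Gamma> T u U \<longleftrightarrow> (\<exists>I. gamma_ideal \<Gamma> T u I \<and> U = Spec \<Gamma> T u - V_Spec \<Gamma> T u I)"

text \<open>That \<^const>\<open>Spec_open\<close> satisfies \<^const>\<open>istopology\<close> is lemma \<open>istopology_Spec\<close> below.\<close>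

definition Spec_top ::
    "('g, 'k) monoid_scheme \<Rightarrow> ('a, 'm) ring_scheme \<Rightarrow> ('g \<Rightarrow> 'a) \<Rightarrow> 'a set topology" where
  "Spec_top \<Gamma> T u = topology (Spec_open \<Gamma> T u)"

text \<open>The fraction \<open>a/s\<close> is the class of the pair \<open>(a, s)\<close>. The operations combine
  representatives; the unions are over families of equal classes.\<close>

definition fraction :: "('a, 'm) ring_scheme \<Rightarrow> 'a set \<Rightarrow> 'a \<Rightarrow> 'a \<Rightarrow> ('a \<times> 'a) set" where
  "fraction T S a s = {(b, t). b \<in> carrier T \<and> t \<in> S \<and>
     (\<exists>w\<in>S. w \<otimes>\<^bsub>T\<^esub> a \<otimes>\<^bsub>T\<^esub> t = w \<otimes>\<^bsub>T\<^esub> b \<otimes>\<^bsub>T\<^esub> s)}"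

definition localization :: "('a, 'm) ring_scheme \<Rightarrow> 'a set \<Rightarrow> ('a \<times> 'a) set ring" where
  "localization T S =
    \<lparr>carrier = {fraction T S a s | a s. a \<in> carrier T \<and> s \<in> S},
     mult = (\<lambda>X Y. \<Union>(a, s)\<in>X. \<Union>(b, t)\<in>Y. fraction T S (a \<otimes>\<^bsub>T\<^esub> b) (s \<otimes>\<^bsub>T\<^esub> t)),
     one = fraction T S \<one>\<^bsub>T\<^esub> \<one>\<^bsub>T\<^esub>,
     zero = fraction T S \<zero>\<^bsub>T\<^esub> \<one>\<^bsub>T\<^esub>,
     add = (\<lambda>X Y. \<Union>(a, s)\<in>X. \<Union>(b, t)\<in>Y.
              fraction T S (a \<otimes>\<^bsub>T\<^esub> t \<oplus>\<^bsub>T\<^esub> b \<otimes>\<^bsub>T\<^esub> s) (s \<otimes>\<^bsub>T\<^esub> t))\<rparr>"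

definition powers :: "('a, 'm) ring_scheme \<Rightarrow> 'a \<Rightarrow> 'a set" where
  "powers T f = {f [^]\<^bsub>T\<^esub> n | n::nat. True}"

abbreviation loc_at :: "('a, 'm) ring_scheme \<Rightarrow> 'a \<Rightarrow> ('a \<times> 'a) set ring" where
  "loc_at T f \<equiv> localization T (powers T f)"

definition loc_map :: "('a, 'm) ring_scheme \<Rightarrow> 'a \<Rightarrow> 'a \<Rightarrow> ('a \<times> 'a) set" where
  "loc_map T f a = fraction T (powers T f) a \<one>\<^bsub>T\<^esub>"

locale presheaf_semirings =
  fixes X :: "'x topology"
    and F :: "'x set \<Rightarrow> ('b, 'n) ring_scheme"
    and \<rho> :: "'x set \<Rightarrow> 'x set \<Rightarrow> 'b \<Rightarrow> 'b"
  assumes sections_semiring: "openin X U \<Longrightarrow> comm_semiring (F U)"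
    and res_hom: "\<lbrakk>openin X U; openin X V; V \<subseteq> U\<rbrakk> \<Longrightarrow> \<rho> U V \<in> semiring_hom (F U) (F V)"
    and res_id: "\<lbrakk>openin X U; s \<in> carrier (F U)\<rbrakk> \<Longrightarrow> \<rho> U U s = s"
    and res_comp: "\<lbrakk>openin X U; openin X V; openin X W; W \<subseteq> V; V \<subseteq> U; s \<in> carrier (F U)\<rbrakk>
      \<Longrightarrow> \<rho> V W (\<rho> U V s) = \<rho> U W s"

locale sheaf_semirings = presheaf_semirings +
  assumes locality: "\<lbrakk>\<And>V. V \<in> \<U> \<Longrightarrow> openin X V;
        s \<in> carrier (F (\<Union>\<U>)); t \<in> carrier (F (\<Union>\<U>));
        \<And>V. V \<in> \<U> \<Longrightarrow> \<rho> (\<Union>\<U>) V s = \<rho> (\<Union>\<U>) V t\<rbrakk> \<Longrightarrow> s = t"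
    and gluing: "\<lbrakk>\<And>V. V \<in> \<U> \<Longrightarrow> openin X V;
        \<And>V. V \<in> \<U> \<Longrightarrow> \<sigma> V \<in> carrier (F V);
        \<And>V W. \<lbrakk>V \<in> \<U>; W \<in> \<U>\<rbrakk> \<Longrightarrow> \<rho> V (V \<inter> W) (\<sigma> V) = \<rho> W (V \<inter> W) (\<sigma> W)\<rbrakk>
      \<Longrightarrow> \<exists>s\<in>carrier (F (\<Union>\<U>)). \<forall>V\<in>\<U>. \<rho> (\<Union>\<U>) V s = \<sigma> V"

text \<open>The germ at \<open>p\<close> of a section \<open>s\<close> over \<open>U\<close> is the class of the pair \<open>(U, s)\<close>.\<close>

definition germ ::
    "'x topology \<Rightarrow> ('x set \<Rightarrow> ('b, 'n) ring_scheme) \<Rightarrow> ('x set \<Rightarrow> 'x set \<Rightarrow> 'b \<Rightarrow> 'b) \<Rightarrow>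
     'x \<Rightarrow> 'x set \<Rightarrow> 'b \<Rightarrow> ('x set \<times> 'b) set" where
  "germ X F \<rho> p U s = {(V, t). openin X V \<and> p \<in> V \<and> t \<in> carrier (F V) \<and>
     (\<exists>W. openin X W \<and> p \<in> W \<and> W \<subseteq> U \<inter> V \<and> \<rho> U W s = \<rho> V W t)}"

definition stalk ::
    "'x topology \<Rightarrow> ('x set \<Rightarrow> ('b, 'n) ring_scheme) \<Rightarrow> ('x set \<Rightarrow> 'x set \<Rightarrow> 'b \<Rightarrow> 'b) \<Rightarrow>
     'x \<Rightarrow> ('x set \<times> 'b) set ring" where
  "stalk X F \<rho> p =
    \<lparr>carrier = {germ X F \<rho> p U s | U s. openin X U \<and> p \<in> U \<and> s \<in> carrier (F U)},
     mult = (\<lambda>A B. \<Union>(U, s)\<in>A. \<Union>(V, t)\<in>B.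
        germ X F \<rho> p (U \<inter> V) (\<rho> U (U \<inter> V) s \<otimes>\<^bsub>F (U \<inter> V)\<^esub> \<rho> V (U \<inter> V) t)),
     one = germ X F \<rho> p (topspace X) \<one>\<^bsub>F (topspace X)\<^esub>,
     zero = germ X F \<rho> p (topspace X) \<zero>\<^bsub>F (topspace X)\<^esub>,
     add = (\<lambda>A B. \<Union>(U, s)\<in>A. \<Union>(V, t)\<in>B.
        germ X F \<rho> p (U \<inter> V) (\<rho> U (U \<inter> V) s \<oplus>\<^bsub>F (U \<inter> V)\<^esub> \<rho> V (U \<inter> V) t))\<rparr>"

text \<open>The structure sheaf is determined up to unique isomorphism only, and \<open>T\<^sub>f\<close> is not
  literally a function of \<open>D(f)\<close>. The identification of the sections over \<open>D(f)\<close> with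
  \<open>T\<^sub>f\<close> is therefore recorded by isomorphisms \<open>\<theta> f\<close>, which carry the restriction from
  \<open>D(f)\<close> to \<open>D(g)\<close> to the homomorphism from \<open>T\<^sub>f\<close> to \<open>T\<^sub>g\<close> under \<open>T\<close>.
  Existence of such a sheaf is theorem \<open>structure_sheaf_exists\<close> below.\<close>

locale structure_sheaf =
  ternary_gamma_semiring \<Gamma> T u + sheaf_semirings "Spec_top \<Gamma> T u" F \<rho>
  for \<Gamma> :: "('g, 'k) monoid_scheme" (structure)
    and T :: "('a, 'm) ring_scheme" (structure)
    and u :: "'g \<Rightarrow> 'a"
    and F :: "'a set set \<Rightarrow> ('b, 'n) ring_scheme"
    and \<rho> :: "'a set set \<Rightarrow> 'a set set \<Rightarrow> 'b \<Rightarrow> 'b"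
    and \<theta> :: "'a \<Rightarrow> ('a \<times> 'a) set \<Rightarrow> 'b" +
  assumes theta_hom: "f \<in> carrier T \<Longrightarrow> \<theta> f \<in> semiring_hom (loc_at T f) (F (D_Spec \<Gamma> T u f))"
    and theta_bij: "f \<in> carrier T \<Longrightarrow>
      bij_betw (\<theta> f) (carrier (loc_at T f)) (carrier (F (D_Spec \<Gamma> T u f)))"
    and theta_res: "\<lbrakk>f \<in> carrier T; g \<in> carrier T; D_Spec \<Gamma> T u g \<subseteq> D_Spec \<Gamma> T u f\<rbrakk> \<Longrightarrow>
      \<exists>r \<in> semiring_hom (loc_at T f) (loc_at T g).
        (\<forall>a\<in>carrier T. r (loc_map T f a) = loc_map T g a) \<and>
        (\<forall>x\<in>carrier (loc_at T f).
           \<rho> (D_Spec \<Gamma> T u f) (D_Spec \<Gamma> T u g) (\<theta> f x) = \<theta> g (r x))"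

text \<open>The image of \<open>a\<close> under the map from \<open>T\<close>, which is \<open>T\<close> localized at \<open>1\<close> and
  hence the sections over \<open>D(1)\<close>, the whole spectrum, to the sections over \<open>U\<close>.\<close>

definition can_section ::
    "('g, 'k) monoid_scheme \<Rightarrow> ('a, 'm) ring_scheme \<Rightarrow> ('g \<Rightarrow> 'a) \<Rightarrow>
     ('a set set \<Rightarrow> 'a set set \<Rightarrow> 'b \<Rightarrow> 'b) \<Rightarrow> ('a \<Rightarrow> ('a \<times> 'a) set \<Rightarrow> 'b) \<Rightarrow>
     'a set set \<Rightarrow> 'a \<Rightarrow> 'b" where
  "can_section \<Gamma> T u \<rho> \<theta> U a =
     \<rho> (D_Spec \<Gamma> T u \<one>\<^bsub>T\<^esub>) U (\<theta> \<one>\<^bsub>T\<^esub> (loc_map T \<one>\<^bsub>T\<^esub> a))"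

definition stalk_map ::
    "('g, 'k) monoid_scheme \<Rightarrow> ('a, 'm) ring_scheme \<Rightarrow> ('g \<Rightarrow> 'a) \<Rightarrow>
     ('a set set \<Rightarrow> ('b, 'n) ring_scheme) \<Rightarrow>
     ('a set set \<Rightarrow> 'a set set \<Rightarrow> 'b \<Rightarrow> 'b) \<Rightarrow> ('a \<Rightarrow> ('a \<times> 'a) set \<Rightarrow> 'b) \<Rightarrow>
     'a set \<Rightarrow> 'a \<Rightarrow> ('a set set \<times> 'b) set" where
  "stalk_map \<Gamma> T u F \<rho> \<theta> P a =
     germ (Spec_top \<Gamma> T u) F \<rho> P (Spec \<Gamma> T u) (can_section \<Gamma> T u \<rho> \<theta> (Spec \<Gamma> T u) a)"

definition unit_section ::
    "('g, 'k) monoid_scheme \<Rightarrow> ('a, 'm) ring_scheme \<Rightarrow> ('g \<Rightarrow> 'a) \<Rightarrow>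
     ('a set set \<Rightarrow> 'a set set \<Rightarrow> 'b \<Rightarrow> 'b) \<Rightarrow> ('a \<Rightarrow> ('a \<times> 'a) set \<Rightarrow> 'b) \<Rightarrow>
     'a set set \<Rightarrow> 'g \<Rightarrow> 'b" where
  "unit_section \<Gamma> T u \<rho> \<theta> U \<gamma> = can_section \<Gamma> T u \<rho> \<theta> U (u \<gamma>)"

definition stalk_unit ::
    "('g, 'k) monoid_scheme \<Rightarrow> ('a, 'm) ring_scheme \<Rightarrow> ('g \<Rightarrow> 'a) \<Rightarrow>
     ('a set set \<Rightarrow> ('b, 'n) ring_scheme) \<Rightarrow>
     ('a set set \<Rightarrow> 'a set set \<Rightarrow> 'b \<Rightarrow> 'b) \<Rightarrow> ('a \<Rightarrow> ('a \<times> 'a) set \<Rightarrow> 'b) \<Rightarrow>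
     'a set \<Rightarrow> 'g \<Rightarrow> ('a set set \<times> 'b) set" where
  "stalk_unit \<Gamma> T u F \<rho> \<theta> P \<gamma> =
     germ (Spec_top \<Gamma> T u) F \<rho> P (Spec \<Gamma> T u) (unit_section \<Gamma> T u \<rho> \<theta> (Spec \<Gamma> T u) \<gamma>)"

text \<open>The operation \<open>B\<close> on the stalk at \<open>p\<close> is induced by the brackets on sections, where
  \<open>w U \<gamma>\<close> is the unit \<open>u\<^sub>\<gamma>\<close> of the sections over \<open>U\<close>. Any three germs have representatives
  over a common \<open>U\<close>.\<close>

definition inherits_bracket ::
    "'x topology \<Rightarrow> ('x set \<Rightarrow> ('b, 'n) ring_scheme) \<Rightarrow> ('x set \<Rightarrow> 'x set \<Rightarrow> 'b \<Rightarrow> 'b) \<Rightarrow>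
     'x \<Rightarrow> ('x set \<Rightarrow> 'g \<Rightarrow> 'b) \<Rightarrow> 'g \<Rightarrow>
     (('x set \<times> 'b) set \<times> ('x set \<times> 'b) set \<times> ('x set \<times> 'b) set \<Rightarrow> ('x set \<times> 'b) set) \<Rightarrow> bool" where
  "inherits_bracket X F \<rho> p w \<gamma> B \<longleftrightarrow>
     (\<forall>U s\<^sub>1 s\<^sub>2 s\<^sub>3. openin X U \<and> p \<in> U \<and>
        s\<^sub>1 \<in> carrier (F U) \<and> s\<^sub>2 \<in> carrier (F U) \<and> s\<^sub>3 \<in> carrier (F U) \<longrightarrow>
        B (germ X F \<rho> p U s\<^sub>1, germ X F \<rho> p U s\<^sub>2, germ X F \<rho> p U s\<^sub>3) =
          germ X F \<rho> p U (tbracket (F U) (w U) \<gamma> s\<^sub>1 s\<^sub>2 s\<^sub>3))"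

context ternary_gamma_semiring
begin

lemma u_closed: "\<gamma> \<in> carrier \<Gamma> \<Longrightarrow> u \<gamma> \<in> carrier T"
  using u_hom Units_closed by (auto simp: hom_def units_of_def)

lemma u_one: "u \<one>\<^bsub>\<Gamma>\<^esub> = \<one>\<^bsub>T\<^esub>"
  using hom_one[OF u_hom \<Gamma>.is_group units_group] by (simp add: units_of_def)

lemma gamma_ideal_iff:
  "gamma_ideal \<Gamma> T u I \<longleftrightarrow> I \<subseteq> carrier T \<and> \<zero>\<^bsub>T\<^esub> \<in> I \<and>
     (\<forall>a\<in>I. \<forall>b\<in>I. a \<oplus>\<^bsub>T\<^esub> b \<in> I) \<and> (\<forall>a\<in>I. \<forall>b\<in>carrier T. a \<otimes>\<^bsub>T\<^esub> b \<in> I)"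
  (is "_ \<longleftrightarrow> ?R")
proof
  assume g: "gamma_ideal \<Gamma> T u I"
  have sub: "submonoid I (add_monoid T)" using g by (simp add: gamma_ideal_def)
  have "a \<otimes>\<^bsub>T\<^esub> b \<in> I" if "a \<in> I" "b \<in> carrier T" for a b
  proof -
    have "a \<in> carrier T" using submonoid.subset[OF sub] that by auto
    moreover have "tbracket T u \<one>\<^bsub>\<Gamma>\<^esub> a b \<one>\<^bsub>T\<^esub> \<in> I"
      using g that unfolding gamma_ideal_def by blast
    ultimately show ?thesis using that by (simp add: tbracket_def u_one)
  qed
  then show ?R using sub by (auto simp: submonoid_def)
next
  assume R: ?R
  then have "submonoid I (add_monoid T)" by (auto simp: submonoid_def)
  moreover have "tbracket T u \<gamma> a b c \<in> I"
    if "a \<in> I" "b \<in> carrier T" "c \<in> carrier T" "\<gamma> \<in> carrier \<Gamma>" for a b c \<gamma>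
    using R that by (simp add: tbracket_def u_closed)
  ultimately show "gamma_ideal \<Gamma> T u I" by (auto simp: gamma_ideal_def)
qed

lemma gamma_ideal_one: "\<lbrakk>gamma_ideal \<Gamma> T u I; \<one>\<^bsub>T\<^esub> \<in> I\<rbrakk> \<Longrightarrow> I = carrier T"
  unfolding gamma_ideal_iff by (metis l_one subsetI subset_antisym)

lemma prime_iff:
  "prime_gamma_ideal \<Gamma> T u P \<longleftrightarrow> gamma_ideal \<Gamma> T u P \<and> \<one>\<^bsub>T\<^esub> \<notin> P \<and>
     (\<forall>a\<in>carrier T. \<forall>b\<in>carrier T. a \<otimes>\<^bsub>T\<^esub> b \<in> P \<longrightarrow> a \<in> P \<or> b \<in> P)" (is "_ \<longleftrightarrow> ?R")
proof
  assume p: "prime_gamma_ideal \<Gamma> T u P"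
  then have g: "gamma_ideal \<Gamma> T u P" and one: "\<one>\<^bsub>T\<^esub> \<notin> P"
    using gamma_ideal_one by (auto simp: prime_gamma_ideal_def)
  have "a \<in> P \<or> b \<in> P" if "a \<in> carrier T" "b \<in> carrier T" "a \<otimes>\<^bsub>T\<^esub> b \<in> P" for a b
  proof -
    have "tbracket T u \<one>\<^bsub>\<Gamma>\<^esub> a b \<one>\<^bsub>T\<^esub> \<in> P" using that by (simp add: tbracket_def u_one)
    then show ?thesis using p one that unfolding prime_gamma_ideal_def
      by (meson \<Gamma>.one_closed one_closed)
  qed
  then show ?R using g one by blast
next
  assume R: ?R
  have "a \<in> P \<or> b \<in> P \<or> c \<in> P"
    if c: "a \<in> carrier T" "b \<in> carrier T" "c \<in> carrier T" "\<gamma> \<in> carrier \<Gamma>"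
      and t: "tbracket T u \<gamma> a b c \<in> P" for a b c \<gamma>
  proof -
    have U: "u \<gamma> \<in> Units T" using u_hom c by (auto simp: hom_def units_of_def)
    have "u \<gamma> \<notin> P"
    proof
      assume "u \<gamma> \<in> P"
      then have "u \<gamma> \<otimes>\<^bsub>T\<^esub> inv\<^bsub>T\<^esub> u \<gamma> \<in> P"
        using R Units_inv_closed[OF U] unfolding gamma_ideal_iff by blast
      then have "\<one>\<^bsub>T\<^esub> \<in> P" using Units_r_inv[OF U] by simp
      then show False using R by simp
    qed
    then have "a \<otimes>\<^bsub>T\<^esub> b \<otimes>\<^bsub>T\<^esub> c \<in> P" using R c t u_closed[of \<gamma>]
      unfolding tbracket_def by (meson m_closed)
    then show ?thesis using R c by (meson m_closed)
  qed
  then show "prime_gamma_ideal \<Gamma> T u P" using R by (auto simp: prime_gamma_ideal_def)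
qed

lemma Spec_iff:
  "P \<in> Spec \<Gamma> T u \<longleftrightarrow> gamma_ideal \<Gamma> T u P \<and> \<one>\<^bsub>T\<^esub> \<notin> P \<and>
     (\<forall>a\<in>carrier T. \<forall>b\<in>carrier T. a \<otimes>\<^bsub>T\<^esub> b \<in> P \<longrightarrow> a \<in> P \<or> b \<in> P)"
  by (simp add: Spec_def prime_iff)

lemma gamma_ideal_carrier: "gamma_ideal \<Gamma> T u (carrier T)"
  by (simp add: gamma_ideal_iff)

lemma gamma_ideal_Inter:
  "\<lbrakk>\<And>I. I \<in> \<I> \<Longrightarrow> gamma_ideal \<Gamma> T u I; \<I> \<noteq> {}\<rbrakk> \<Longrightarrow> gamma_ideal \<Gamma> T u (\<Inter>\<I>)"
  unfolding gamma_ideal_iff by (intro conjI ballI InterI) blast+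

definition gen :: "'a set \<Rightarrow> 'a set" where
  "gen A = \<Inter>{I. gamma_ideal \<Gamma> T u I \<and> A \<subseteq> I}"

lemma gamma_ideal_gen: "A \<subseteq> carrier T \<Longrightarrow> gamma_ideal \<Gamma> T u (gen A)"
  unfolding gen_def by (rule gamma_ideal_Inter) (auto intro: gamma_ideal_carrier)

lemma gen_subset_iff: "gamma_ideal \<Gamma> T u I \<Longrightarrow> gen A \<subseteq> I \<longleftrightarrow> A \<subseteq> I"
  unfolding gen_def by blast

lemma Spec_open_iff:
  "Spec_open \<Gamma> T u U \<longleftrightarrow> (\<exists>A\<subseteq>carrier T. U = {P \<in> Spec \<Gamma> T u. \<not> A \<subseteq> P})"
proof
  assume "Spec_open \<Gamma> T u U"
  then obtain I where I: "gamma_ideal \<Gamma> T u I" "U = Spec \<Gamma> T u - V_Spec \<Gamma> T u I"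
    by (auto simp: Spec_open_def)
  then have "I \<subseteq> carrier T" by (simp add: gamma_ideal_iff)
  moreover have "U = {P \<in> Spec \<Gamma> T u. \<not> I \<subseteq> P}" using I(2) by (auto simp: V_Spec_def)
  ultimately show "\<exists>A\<subseteq>carrier T. U = {P \<in> Spec \<Gamma> T u. \<not> A \<subseteq> P}" by blast
next
  assume "\<exists>A\<subseteq>carrier T. U = {P \<in> Spec \<Gamma> T u. \<not> A \<subseteq> P}"
  then obtain A where A: "A \<subseteq> carrier T" "U = {P \<in> Spec \<Gamma> T u. \<not> A \<subseteq> P}"
    by (elim exE conjE)
  have "gen A \<subseteq> P \<longleftrightarrow> A \<subseteq> P" if "P \<in> Spec \<Gamma> T u" for P
    using that gen_subset_iff unfolding Spec_iff by blast
  then have "U = Spec \<Gamma> T u - V_Spec \<Gamma> T u (gen A)"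
    unfolding A(2) V_Spec_def by blast
  then show "Spec_open \<Gamma> T u U" using gamma_ideal_gen[OF A(1)] by (auto simp: Spec_open_def)
qed

lemma D_Spec_mult:
  assumes "f \<in> carrier T" "g \<in> carrier T"
  shows "D_Spec \<Gamma> T u (f \<otimes>\<^bsub>T\<^esub> g) = D_Spec \<Gamma> T u f \<inter> D_Spec \<Gamma> T u g"
proof -
  have "f \<otimes>\<^bsub>T\<^esub> g \<in> P \<longleftrightarrow> f \<in> P \<or> g \<in> P" if P: "P \<in> Spec \<Gamma> T u" for P
  proof
    show "f \<otimes>\<^bsub>T\<^esub> g \<in> P \<Longrightarrow> f \<in> P \<or> g \<in> P" using P assms unfolding Spec_iff by blast
  next
    have "x \<otimes>\<^bsub>T\<^esub> y \<in> P" if "x \<in> P" "y \<in> carrier T" for x y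
      using P that unfolding Spec_iff gamma_ideal_iff by blast
    then show "f \<in> P \<or> g \<in> P \<Longrightarrow> f \<otimes>\<^bsub>T\<^esub> g \<in> P" using assms m_comm[OF assms] by metis
  qed
  then show ?thesis unfolding D_Spec_def by blast
qed

lemma Spec_open_iff_D_Spec:
  "Spec_open \<Gamma> T u U \<longleftrightarrow>
     U \<subseteq> Spec \<Gamma> T u \<and> (\<forall>P\<in>U. \<exists>f\<in>carrier T. f \<notin> P \<and> D_Spec \<Gamma> T u f \<subseteq> U)" (is "_ \<longleftrightarrow> ?R")
proof
  assume "Spec_open \<Gamma> T u U"
  then obtain A where A: "A \<subseteq> carrier T" "U = {P \<in> Spec \<Gamma> T u. \<not> A \<subseteq> P}"
    by (auto simp: Spec_open_iff)
  show ?R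
  proof (intro conjI ballI)
    show "U \<subseteq> Spec \<Gamma> T u" using A(2) by blast
    fix P assume "P \<in> U"
    then obtain f where "f \<in> A" "f \<notin> P" using A(2) by blast
    moreover have "D_Spec \<Gamma> T u f \<subseteq> U" using A(2) \<open>f \<in> A\<close> by (auto simp: D_Spec_def)
    ultimately show "\<exists>f\<in>carrier T. f \<notin> P \<and> D_Spec \<Gamma> T u f \<subseteq> U" using A(1) by blast
  qed
next
  assume R: ?R
  let ?A = "{f \<in> carrier T. D_Spec \<Gamma> T u f \<subseteq> U}"
  have "U = {P \<in> Spec \<Gamma> T u. \<not> ?A \<subseteq> P}"
  proof (intro subset_antisym subsetI)
    fix P assume "P \<in> U"
    then show "P \<in> {P \<in> Spec \<Gamma> T u. \<not> ?A \<subseteq> P}" using R by blast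
  next
    fix P assume "P \<in> {P \<in> Spec \<Gamma> T u. \<not> ?A \<subseteq> P}"
    then obtain f where "f \<in> ?A" "f \<notin> P" "P \<in> Spec \<Gamma> T u" by blast
    then show "P \<in> U" by (auto simp: D_Spec_def)
  qed
  moreover have "?A \<subseteq> carrier T" by blast
  ultimately show "Spec_open \<Gamma> T u U" unfolding Spec_open_iff by blast
qed

lemma istopology_Spec: "istopology (Spec_open \<Gamma> T u)"
  unfolding istopology_def
proof (intro conjI allI impI)
  fix U V assume U: "Spec_open \<Gamma> T u U" and V: "Spec_open \<Gamma> T u V"
  show "Spec_open \<Gamma> T u (U \<inter> V)"
    unfolding Spec_open_iff_D_Spec
  proof (intro conjI ballI)
    show "U \<inter> V \<subseteq> Spec \<Gamma> T u" using U by (auto simp: Spec_open_iff_D_Spec)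
    fix P assume P: "P \<in> U \<inter> V"
    obtain f where f: "f \<in> carrier T" "f \<notin> P" "D_Spec \<Gamma> T u f \<subseteq> U"
      using U P unfolding Spec_open_iff_D_Spec by blast
    obtain g where g: "g \<in> carrier T" "g \<notin> P" "D_Spec \<Gamma> T u g \<subseteq> V"
      using V P unfolding Spec_open_iff_D_Spec by blast
    have "P \<in> Spec \<Gamma> T u" using U P unfolding Spec_open_iff_D_Spec by blast
    then have "P \<in> D_Spec \<Gamma> T u (f \<otimes>\<^bsub>T\<^esub> g)" using f g by (simp add: D_Spec_mult) (simp add: D_Spec_def)
    then have "f \<otimes>\<^bsub>T\<^esub> g \<notin> P" by (simp add: D_Spec_def)
    moreover have "D_Spec \<Gamma> T u (f \<otimes>\<^bsub>T\<^esub> g) \<subseteq> U \<inter> V" using f g by (auto simp: D_Spec_mult)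
    ultimately show "\<exists>h\<in>carrier T. h \<notin> P \<and> D_Spec \<Gamma> T u h \<subseteq> U \<inter> V"
      using f g m_closed by blast
  qed
next
  fix \<U> assume "\<forall>U\<in>\<U>. Spec_open \<Gamma> T u U"
  then show "Spec_open \<Gamma> T u (\<Union>\<U>)"
    unfolding Spec_open_iff_D_Spec by (meson Sup_le_iff Sup_upper UnionE subset_trans)
qed

lemma openin_Spec: "openin (Spec_top \<Gamma> T u) U \<longleftrightarrow> Spec_open \<Gamma> T u U"
  by (simp add: Spec_top_def istopology_Spec)

lemma D_Spec_open: "f \<in> carrier T \<Longrightarrow> openin (Spec_top \<Gamma> T u) (D_Spec \<Gamma> T u f)"
  unfolding openin_Spec Spec_open_iff D_Spec_def by (intro exI[of _ "{f}"]) auto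

lemma D_Spec_one: "D_Spec \<Gamma> T u \<one>\<^bsub>T\<^esub> = Spec \<Gamma> T u"
  unfolding D_Spec_def using Spec_iff by blast

lemma topspace_Spec: "topspace (Spec_top \<Gamma> T u) = Spec \<Gamma> T u"
proof
  show "topspace (Spec_top \<Gamma> T u) \<subseteq> Spec \<Gamma> T u"
    unfolding topspace_def openin_Spec Spec_open_def by blast
  show "Spec \<Gamma> T u \<subseteq> topspace (Spec_top \<Gamma> T u)"
    using openin_subset[OF D_Spec_open[OF one_closed]] by (simp add: D_Spec_one)
qed

lemma D_Spec_basis:
  assumes "openin (Spec_top \<Gamma> T u) U" "P \<in> U"
  obtains f where "f \<in> carrier T" "P \<in> D_Spec \<Gamma> T u f" "D_Spec \<Gamma> T u f \<subseteq> U"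
  using assms that unfolding openin_Spec Spec_open_iff_D_Spec D_Spec_def by blast

end

lemma semiring_hom_memI:
  assumes "\<And>x. x \<in> carrier R \<Longrightarrow> h x \<in> carrier S"
    and "\<And>x y. \<lbrakk>x \<in> carrier R; y \<in> carrier R\<rbrakk> \<Longrightarrow> h (x \<otimes>\<^bsub>R\<^esub> y) = h x \<otimes>\<^bsub>S\<^esub> h y"
    and "\<And>x y. \<lbrakk>x \<in> carrier R; y \<in> carrier R\<rbrakk> \<Longrightarrow> h (x \<oplus>\<^bsub>R\<^esub> y) = h x \<oplus>\<^bsub>S\<^esub> h y"
    and "h \<one>\<^bsub>R\<^esub> = \<one>\<^bsub>S\<^esub>" "h \<zero>\<^bsub>R\<^esub> = \<zero>\<^bsub>S\<^esub>"
  shows "h \<in> semiring_hom R S"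
  using assms by (auto simp: semiring_hom_def ring_hom_def)

lemma semiring_homD:
  assumes "h \<in> semiring_hom R S"
  shows "x \<in> carrier R \<Longrightarrow> h x \<in> carrier S"
    and "\<lbrakk>x \<in> carrier R; y \<in> carrier R\<rbrakk> \<Longrightarrow> h (x \<otimes>\<^bsub>R\<^esub> y) = h x \<otimes>\<^bsub>S\<^esub> h y"
    and "\<lbrakk>x \<in> carrier R; y \<in> carrier R\<rbrakk> \<Longrightarrow> h (x \<oplus>\<^bsub>R\<^esub> y) = h x \<oplus>\<^bsub>S\<^esub> h y"
    and "h \<one>\<^bsub>R\<^esub> = \<one>\<^bsub>S\<^esub>" "h \<zero>\<^bsub>R\<^esub> = \<zero>\<^bsub>S\<^esub>"
  using assms by (auto simp: semiring_hom_def ring_hom_def)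

lemma comm_semiringI:
  fixes R (structure)
  assumes "\<And>x y. \<lbrakk>x \<in> carrier R; y \<in> carrier R\<rbrakk> \<Longrightarrow> x \<oplus> y \<in> carrier R"
    and "\<zero> \<in> carrier R" "\<one> \<in> carrier R"
    and "\<And>x y. \<lbrakk>x \<in> carrier R; y \<in> carrier R\<rbrakk> \<Longrightarrow> x \<otimes> y \<in> carrier R"
    and "\<And>x y z. \<lbrakk>x \<in> carrier R; y \<in> carrier R; z \<in> carrier R\<rbrakk> \<Longrightarrow> (x \<oplus> y) \<oplus> z = x \<oplus> (y \<oplus> z)"
    and "\<And>x y. \<lbrakk>x \<in> carrier R; y \<in> carrier R\<rbrakk> \<Longrightarrow> x \<oplus> y = y \<oplus> x"
    and "\<And>x. x \<in> carrier R \<Longrightarrow> \<zero> \<oplus> x = x"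
    and "\<And>x y z. \<lbrakk>x \<in> carrier R; y \<in> carrier R; z \<in> carrier R\<rbrakk> \<Longrightarrow> (x \<otimes> y) \<otimes> z = x \<otimes> (y \<otimes> z)"
    and comm: "\<And>x y. \<lbrakk>x \<in> carrier R; y \<in> carrier R\<rbrakk> \<Longrightarrow> x \<otimes> y = y \<otimes> x"
    and "\<And>x. x \<in> carrier R \<Longrightarrow> \<one> \<otimes> x = x"
    and distr: "\<And>x y z. \<lbrakk>x \<in> carrier R; y \<in> carrier R; z \<in> carrier R\<rbrakk> \<Longrightarrow> (x \<oplus> y) \<otimes> z = x \<otimes> z \<oplus> y \<otimes> z"
    and null: "\<And>x. x \<in> carrier R \<Longrightarrow> \<zero> \<otimes> x = \<zero>"
  shows "comm_semiring R"
proof -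
  interpret m: comm_monoid R
    by (rule comm_monoidI) (fact assms)+
  interpret abelian_monoid R
    by (rule abelian_monoidI) (fact assms)+
  show ?thesis
  proof
    fix x y z assume "x \<in> carrier R" "y \<in> carrier R" "z \<in> carrier R"
    then show "(x \<oplus> y) \<otimes> z = x \<otimes> z \<oplus> y \<otimes> z" by (rule distr)
  next
    fix x y z assume c: "x \<in> carrier R" "y \<in> carrier R" "z \<in> carrier R"
    then have "z \<otimes> (x \<oplus> y) = (x \<oplus> y) \<otimes> z" using assms(1) comm by simp
    also have "\<dots> = x \<otimes> z \<oplus> y \<otimes> z" using c by (rule distr)
    finally show "z \<otimes> (x \<oplus> y) = z \<otimes> x \<oplus> z \<otimes> y" using comm c by simp
  next
    fix x assume c: "x \<in> carrier R"
    show "\<zero> \<otimes> x = \<zero>" using null c .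
    show "x \<otimes> \<zero> = \<zero>" using null[OF c] comm[OF c assms(2)] by simp
  qed
qed

context comm_semiring
begin

context
  fixes S assumes S: "submonoid S R"
begin

lemma S_carrier [simp]: "s \<in> S \<Longrightarrow> s \<in> carrier R"
  using submonoid.subset[OF S] by blast

lemma S_mult [simp]: "\<lbrakk>s \<in> S; t \<in> S\<rbrakk> \<Longrightarrow> s \<otimes> t \<in> S"
  using submonoid.m_closed[OF S] by blast

lemma S_one [simp]: "\<one> \<in> S"
  using submonoid.one_closed[OF S] .

lemma frac_trans:
  assumes c: "a \<in> carrier R" "b \<in> carrier R" "c \<in> carrier R" "s \<in> S" "t \<in> S" "r \<in> S"
    and w: "w \<in> S" "w \<otimes> a \<otimes> t = w \<otimes> b \<otimes> s" and v: "v \<in> S" "v \<otimes> b \<otimes> r = v \<otimes> c \<otimes> t"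
  shows "\<exists>x\<in>S. x \<otimes> a \<otimes> r = x \<otimes> c \<otimes> s"
proof
  note [simp] = c w(1) v(1) S_carrier[OF w(1)] S_carrier[OF v(1)] S_carrier[OF c(4)]
    S_carrier[OF c(5)] S_carrier[OF c(6)]
  have "(w \<otimes> v \<otimes> t) \<otimes> a \<otimes> r = (v \<otimes> r) \<otimes> (w \<otimes> a \<otimes> t)" by (simp add: m_ac)
  also have "\<dots> = (w \<otimes> s) \<otimes> (v \<otimes> b \<otimes> r)" unfolding w(2) by (simp add: m_ac)
  also have "\<dots> = (w \<otimes> v \<otimes> t) \<otimes> c \<otimes> s" unfolding v(2) by (simp add: m_ac)
  finally show "(w \<otimes> v \<otimes> t) \<otimes> a \<otimes> r = (w \<otimes> v \<otimes> t) \<otimes> c \<otimes> s" .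
  show "w \<otimes> v \<otimes> t \<in> S" by simp
qed

lemma frac_eq_iff:
  assumes c: "a \<in> carrier R" "b \<in> carrier R" "s \<in> S" "t \<in> S"
  shows "fraction R S a s = fraction R S b t \<longleftrightarrow> (\<exists>w\<in>S. w \<otimes> a \<otimes> t = w \<otimes> b \<otimes> s)" (is "?l \<longleftrightarrow> ?r")
proof
  have "(b, t) \<in> fraction R S b t" using c unfolding fraction_def by blast
  then show "?l \<Longrightarrow> ?r" unfolding fraction_def by blast
next
  assume ?r
  then obtain w where w: "w \<in> S" "w \<otimes> a \<otimes> t = w \<otimes> b \<otimes> s" by blast
  have "(\<exists>x\<in>S. x \<otimes> a \<otimes> r = x \<otimes> d \<otimes> s) \<longleftrightarrow> (\<exists>x\<in>S. x \<otimes> b \<otimes> r = x \<otimes> d \<otimes> t)"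
    if d: "d \<in> carrier R" "r \<in> S" for d r
  proof
    assume "\<exists>x\<in>S. x \<otimes> b \<otimes> r = x \<otimes> d \<otimes> t"
    then show "\<exists>x\<in>S. x \<otimes> a \<otimes> r = x \<otimes> d \<otimes> s"
      using frac_trans[OF c(1,2) d(1) c(3,4) d(2) w] by blast
  next
    assume "\<exists>x\<in>S. x \<otimes> a \<otimes> r = x \<otimes> d \<otimes> s"
    then show "\<exists>x\<in>S. x \<otimes> b \<otimes> r = x \<otimes> d \<otimes> t"
      using frac_trans[OF c(2,1) d(1) c(4,3) d(2) w(1) w(2)[symmetric]] by blast
  qed
  then show ?l unfolding fraction_def by blast
qed

lemma frac_eqI:
  assumes "a \<in> carrier R" "b \<in> carrier R" "s \<in> S" "t \<in> S" "a \<otimes> t = b \<otimes> s"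
  shows "fraction R S a s = fraction R S b t"
  using assms by (subst frac_eq_iff) (auto intro!: bexI[of _ \<one>])

lemma frac_self: "\<lbrakk>a \<in> carrier R; s \<in> S\<rbrakk> \<Longrightarrow> (a, s) \<in> fraction R S a s"
  unfolding fraction_def by blast

lemma frac_memD:
  assumes "(b, t) \<in> fraction R S a s" "a \<in> carrier R" "s \<in> S"
  shows "b \<in> carrier R" "t \<in> S" "fraction R S b t = fraction R S a s"
proof -
  show b: "b \<in> carrier R" "t \<in> S" using assms(1) by (auto simp: fraction_def)
  have "fraction R S a s = fraction R S b t"
    using assms b by (subst frac_eq_iff) (auto simp: fraction_def)
  then show "fraction R S b t = fraction R S a s" ..
qed

lemma frac_mult_cong:
  assumes c: "a \<in> carrier R" "a' \<in> carrier R" "b \<in> carrier R" "b' \<in> carrier R"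
      "s \<in> S" "s' \<in> S" "t \<in> S" "t' \<in> S"
    and e: "fraction R S a s = fraction R S a' s'" "fraction R S b t = fraction R S b' t'"
  shows "fraction R S (a \<otimes> b) (s \<otimes> t) = fraction R S (a' \<otimes> b') (s' \<otimes> t')"
proof -
  obtain w where w: "w \<in> S" "w \<otimes> a \<otimes> s' = w \<otimes> a' \<otimes> s" using e c by (auto simp: frac_eq_iff)
  obtain v where v: "v \<in> S" "v \<otimes> b \<otimes> t' = v \<otimes> b' \<otimes> t" using e c by (auto simp: frac_eq_iff)
  have "(w \<otimes> v) \<otimes> (a \<otimes> b) \<otimes> (s' \<otimes> t') = (w \<otimes> a \<otimes> s') \<otimes> (v \<otimes> b \<otimes> t')"
    using c w(1) v(1) by (simp add: m_ac)
  also have "\<dots> = (w \<otimes> v) \<otimes> (a' \<otimes> b') \<otimes> (s \<otimes> t)"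
    unfolding w(2) v(2) using c w(1) v(1) by (simp add: m_ac)
  finally show ?thesis using c w v by (subst frac_eq_iff) (auto intro!: bexI[of _ "w \<otimes> v"])
qed

lemma frac_add_cong:
  assumes c: "a \<in> carrier R" "a' \<in> carrier R" "b \<in> carrier R" "b' \<in> carrier R"
      "s \<in> S" "s' \<in> S" "t \<in> S" "t' \<in> S"
    and e: "fraction R S a s = fraction R S a' s'" "fraction R S b t = fraction R S b' t'"
  shows "fraction R S (a \<otimes> t \<oplus> b \<otimes> s) (s \<otimes> t) = fraction R S (a' \<otimes> t' \<oplus> b' \<otimes> s') (s' \<otimes> t')"
proof -
  obtain w where w: "w \<in> S" "w \<otimes> a \<otimes> s' = w \<otimes> a' \<otimes> s" using e c by (auto simp: frac_eq_iff)
  obtain v where v: "v \<in> S" "v \<otimes> b \<otimes> t' = v \<otimes> b' \<otimes> t" using e c by (auto simp: frac_eq_iff)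
  have "(w \<otimes> v) \<otimes> (a \<otimes> t \<oplus> b \<otimes> s) \<otimes> (s' \<otimes> t') =
      (w \<otimes> a \<otimes> s') \<otimes> (v \<otimes> t \<otimes> t') \<oplus> (v \<otimes> b \<otimes> t') \<otimes> (w \<otimes> s \<otimes> s')"
    using c w(1) v(1) by (simp add: m_ac l_distr r_distr)
  also have "\<dots> = (w \<otimes> v) \<otimes> (a' \<otimes> t' \<oplus> b' \<otimes> s') \<otimes> (s \<otimes> t)"
    unfolding w(2) v(2) using c w(1) v(1) by (simp add: m_ac l_distr r_distr)
  finally show ?thesis using c w v by (subst frac_eq_iff) (auto intro!: bexI[of _ "w \<otimes> v"])
qed

lemma UN_frac:
  assumes "a \<in> carrier R" "s \<in> S"
    and "\<And>a' s'. \<lbrakk>a' \<in> carrier R; s' \<in> S; fraction R S a' s' = fraction R S a s\<rbrakk> \<Longrightarrow> g a' s' = Z"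
  shows "(\<Union>(a, s)\<in>fraction R S a s. g a s) = Z"
proof -
  have "g (fst p) (snd p) = Z" if "p \<in> fraction R S a s" for p
    using assms(3)[of "fst p" "snd p"] frac_memD[of "fst p" "snd p"] that assms(1,2) by simp
  moreover have "fraction R S a s \<noteq> {}" using frac_self[OF assms(1,2)] by blast
  ultimately show ?thesis by (simp add: case_prod_unfold)
qed

lemma loc_mult:
  assumes c: "a \<in> carrier R" "b \<in> carrier R" "s \<in> S" "t \<in> S"
  shows "fraction R S a s \<otimes>\<^bsub>localization R S\<^esub> fraction R S b t = fraction R S (a \<otimes> b) (s \<otimes> t)"
  unfolding localization_def
  apply simp
  apply (rule UN_frac[OF c(1,3)])
  apply (rule UN_frac[OF c(2,4)])
  apply (rule frac_mult_cong; (assumption | rule c))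
  done

lemma loc_add:
  assumes c: "a \<in> carrier R" "b \<in> carrier R" "s \<in> S" "t \<in> S"
  shows "fraction R S a s \<oplus>\<^bsub>localization R S\<^esub> fraction R S b t = fraction R S (a \<otimes> t \<oplus> b \<otimes> s) (s \<otimes> t)"
  unfolding localization_def
  apply simp
  apply (rule UN_frac[OF c(1,3)])
  apply (rule UN_frac[OF c(2,4)])
  apply (rule frac_add_cong; (assumption | rule c))
  done

lemma loc_one: "\<one>\<^bsub>localization R S\<^esub> = fraction R S \<one> \<one>"
  by (simp add: localization_def)

lemma loc_zero: "\<zero>\<^bsub>localization R S\<^esub> = fraction R S \<zero> \<one>"
  by (simp add: localization_def)

lemma loc_carrier: "x \<in> carrier (localization R S) \<longleftrightarrow> (\<exists>a\<in>carrier R. \<exists>s\<in>S. x = fraction R S a s)"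
  by (auto simp: localization_def)

lemma loc_carrierE:
  assumes "x \<in> carrier (localization R S)"
  obtains a s where "a \<in> carrier R" "s \<in> S" "x = fraction R S a s"
  using assms by (auto simp: loc_carrier)

lemma frac_carrier: "\<lbrakk>a \<in> carrier R; s \<in> S\<rbrakk> \<Longrightarrow> fraction R S a s \<in> carrier (localization R S)"
  by (auto simp: loc_carrier)

lemma comm_semiring_localization: "comm_semiring (localization R S)"
proof (rule comm_semiringI)
  show "\<zero>\<^bsub>localization R S\<^esub> \<in> carrier (localization R S)"
    "\<one>\<^bsub>localization R S\<^esub> \<in> carrier (localization R S)"
    by (simp_all add: loc_zero loc_one frac_carrier)
next
  fix x assume x: "x \<in> carrier (localization R S)"
  then obtain a s where a: "a \<in> carrier R" "s \<in> S" "x = fraction R S a s" by (rule loc_carrierE)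
  show "\<zero>\<^bsub>localization R S\<^esub> \<oplus>\<^bsub>localization R S\<^esub> x = x"
    "\<one>\<^bsub>localization R S\<^esub> \<otimes>\<^bsub>localization R S\<^esub> x = x"
    using a by (simp_all add: loc_zero loc_one loc_add loc_mult)
  have "fraction R S \<zero> s = fraction R S \<zero> \<one>" using a by (intro frac_eqI) auto
  then show "\<zero>\<^bsub>localization R S\<^esub> \<otimes>\<^bsub>localization R S\<^esub> x = \<zero>\<^bsub>localization R S\<^esub>"
    using a by (simp add: loc_zero loc_mult)
next
  fix x y assume x: "x \<in> carrier (localization R S)" and y: "y \<in> carrier (localization R S)"
  from x obtain a s where a: "a \<in> carrier R" "s \<in> S" "x = fraction R S a s" by (rule loc_carrierE)
  from y obtain b t where b: "b \<in> carrier R" "t \<in> S" "y = fraction R S b t" by (rule loc_carrierE)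
  show "x \<oplus>\<^bsub>localization R S\<^esub> y \<in> carrier (localization R S)"
    "x \<otimes>\<^bsub>localization R S\<^esub> y \<in> carrier (localization R S)"
    using a b by (simp_all add: loc_add loc_mult frac_carrier)
  show "x \<oplus>\<^bsub>localization R S\<^esub> y = y \<oplus>\<^bsub>localization R S\<^esub> x"
    "x \<otimes>\<^bsub>localization R S\<^esub> y = y \<otimes>\<^bsub>localization R S\<^esub> x"
    using a b by (simp_all add: loc_add loc_mult m_comm a_comm)
next
  fix x y z assume x: "x \<in> carrier (localization R S)" and y: "y \<in> carrier (localization R S)"
    and z: "z \<in> carrier (localization R S)"
  from x obtain a s where a: "a \<in> carrier R" "s \<in> S" "x = fraction R S a s" by (rule loc_carrierE)
  from y obtain b t where b: "b \<in> carrier R" "t \<in> S" "y = fraction R S b t" by (rule loc_carrierE)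
  from z obtain c r where c: "c \<in> carrier R" "r \<in> S" "z = fraction R S c r" by (rule loc_carrierE)
  show "x \<otimes>\<^bsub>localization R S\<^esub> y \<otimes>\<^bsub>localization R S\<^esub> z =
      x \<otimes>\<^bsub>localization R S\<^esub> (y \<otimes>\<^bsub>localization R S\<^esub> z)"
    using a b c by (simp add: loc_mult m_assoc)
  show "x \<oplus>\<^bsub>localization R S\<^esub> y \<oplus>\<^bsub>localization R S\<^esub> z =
      x \<oplus>\<^bsub>localization R S\<^esub> (y \<oplus>\<^bsub>localization R S\<^esub> z)"
  proof -
    have "(a \<otimes> t \<oplus> b \<otimes> s) \<otimes> r \<oplus> c \<otimes> (s \<otimes> t) = a \<otimes> t \<otimes> r \<oplus> (b \<otimes> s \<otimes> r \<oplus> c \<otimes> (s \<otimes> t))"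
      using a b c by (simp add: l_distr a_assoc)
    also have "b \<otimes> s \<otimes> r \<oplus> c \<otimes> (s \<otimes> t) = (b \<otimes> r \<oplus> c \<otimes> t) \<otimes> s"
      using a b c by (simp add: l_distr r_distr m_ac)
    finally have "(a \<otimes> t \<oplus> b \<otimes> s) \<otimes> r \<oplus> c \<otimes> (s \<otimes> t) = a \<otimes> (t \<otimes> r) \<oplus> (b \<otimes> r \<oplus> c \<otimes> t) \<otimes> s"
      using a b c by (simp add: m_assoc)
    then show ?thesis using a b c by (simp add: loc_add m_assoc)
  qed
  have "fraction R S ((a \<otimes> t \<oplus> b \<otimes> s) \<otimes> c) (s \<otimes> t \<otimes> r) =
      fraction R S (a \<otimes> c \<otimes> (t \<otimes> r) \<oplus> b \<otimes> c \<otimes> (s \<otimes> r)) (s \<otimes> r \<otimes> (t \<otimes> r))"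
  proof -
    define n where "n = (a \<otimes> t \<oplus> b \<otimes> s) \<otimes> c"
    define d where "d = s \<otimes> t \<otimes> r"
    have n: "n \<in> carrier R" and d: "d \<in> S" using a b c by (simp_all add: n_def d_def)
    have "a \<otimes> c \<otimes> (t \<otimes> r) = a \<otimes> t \<otimes> c \<otimes> r" "b \<otimes> c \<otimes> (s \<otimes> r) = b \<otimes> s \<otimes> c \<otimes> r"
      using a b c by (simp_all add: m_ac)
    then have "a \<otimes> c \<otimes> (t \<otimes> r) \<oplus> b \<otimes> c \<otimes> (s \<otimes> r) = n \<otimes> r"
      using a b c by (simp add: n_def l_distr)
    moreover have "s \<otimes> r \<otimes> (t \<otimes> r) = r \<otimes> d" using a b c by (simp add: d_def m_ac)
    moreover have "fraction R S n d = fraction R S (n \<otimes> r) (r \<otimes> d)"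
      using n d c by (intro frac_eqI) (simp_all add: m_assoc)
    ultimately show ?thesis by (simp add: n_def d_def)
  qed
  then show "(x \<oplus>\<^bsub>localization R S\<^esub> y) \<otimes>\<^bsub>localization R S\<^esub> z =
      x \<otimes>\<^bsub>localization R S\<^esub> z \<oplus>\<^bsub>localization R S\<^esub> y \<otimes>\<^bsub>localization R S\<^esub> z"
    using a b c by (simp add: loc_add loc_mult)
qed

end

lemma submonoid_powers:
  assumes "f \<in> carrier R"
  shows "submonoid (powers R f) R"
proof
  show "powers R f \<subseteq> carrier R" using assms by (auto simp: powers_def)
  have pow: "f [^] n \<in> powers R f" for n :: nat by (auto simp: powers_def)
  show "\<one> \<in> powers R f" using pow[of 0] by simp
  show "x \<otimes> y \<in> powers R f" if "x \<in> powers R f" "y \<in> powers R f" for x y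
  proof -
    from that obtain m n :: nat where "x = f [^] m" "y = f [^] n" by (auto simp: powers_def)
    then show ?thesis using pow[of "m + n"] nat_pow_mult[OF assms] by simp
  qed
qed

definition relocate :: "'a set \<Rightarrow> ('a \<times> 'a) set \<Rightarrow> ('a \<times> 'a) set" where
  "relocate S' x = (\<Union>(a, s)\<in>x. fraction R S' a s)"

lemma relocate_frac:
  assumes "submonoid S R" "submonoid S' R" "S \<subseteq> S'" "a \<in> carrier R" "s \<in> S"
  shows "relocate S' (fraction R S a s) = fraction R S' a s"
  unfolding relocate_def
proof (rule UN_frac[OF assms(1,4,5)])
  fix b t assume b: "b \<in> carrier R" "t \<in> S" "fraction R S b t = fraction R S a s"
  then obtain w where "w \<in> S" "w \<otimes> b \<otimes> s = w \<otimes> a \<otimes> t"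
    using assms by (auto simp: frac_eq_iff[OF assms(1)])
  then show "fraction R S' b t = fraction R S' a s"
    using assms b by (subst frac_eq_iff[OF assms(2)]) auto
qed

lemma relocate_hom:
  assumes S: "submonoid S R" and S': "submonoid S' R" and sub: "S \<subseteq> S'"
  shows "relocate S' \<in> semiring_hom (localization R S) (localization R S')"
proof -
  note [simp] = relocate_frac[OF assms] loc_mult[OF S] loc_mult[OF S'] loc_add[OF S] loc_add[OF S']
    S_carrier[OF S] S_mult[OF S] S_one[OF S] loc_one[OF S] loc_one[OF S'] loc_zero[OF S] loc_zero[OF S']
    frac_carrier[OF S']
  have [simp]: "s \<in> S \<Longrightarrow> s \<in> S'" for s using sub by blast
  show ?thesis
  proof (rule semiring_hom_memI)
    fix x assume "x \<in> carrier (localization R S)"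
    then obtain a s where "a \<in> carrier R" "s \<in> S" "x = fraction R S a s" by (rule loc_carrierE[OF S])
    then show "relocate S' x \<in> carrier (localization R S')" by simp
  next
    fix x y assume x: "x \<in> carrier (localization R S)" and y: "y \<in> carrier (localization R S)"
    from x obtain a s where a: "a \<in> carrier R" "s \<in> S" "x = fraction R S a s" by (rule loc_carrierE[OF S])
    from y obtain b t where b: "b \<in> carrier R" "t \<in> S" "y = fraction R S b t" by (rule loc_carrierE[OF S])
    show "relocate S' (x \<otimes>\<^bsub>localization R S\<^esub> y) =
        relocate S' x \<otimes>\<^bsub>localization R S'\<^esub> relocate S' y"
      "relocate S' (x \<oplus>\<^bsub>localization R S\<^esub> y) =
        relocate S' x \<oplus>\<^bsub>localization R S'\<^esub> relocate S' y"
      using a b by simp_all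
  qed simp_all
qed

end

context ternary_gamma_semiring
begin

lemma ideal_closed:
  assumes "gamma_ideal \<Gamma> T u I"
  shows "a \<in> I \<Longrightarrow> a \<in> carrier T" "\<zero>\<^bsub>T\<^esub> \<in> I" "\<lbrakk>a \<in> I; b \<in> I\<rbrakk> \<Longrightarrow> a \<oplus>\<^bsub>T\<^esub> b \<in> I"
    and "\<lbrakk>a \<in> I; b \<in> carrier T\<rbrakk> \<Longrightarrow> a \<otimes>\<^bsub>T\<^esub> b \<in> I" "\<lbrakk>a \<in> I; b \<in> carrier T\<rbrakk> \<Longrightarrow> b \<otimes>\<^bsub>T\<^esub> a \<in> I"
proof -
  show c: "a \<in> I \<Longrightarrow> a \<in> carrier T" "\<zero>\<^bsub>T\<^esub> \<in> I" "\<lbrakk>a \<in> I; b \<in> I\<rbrakk> \<Longrightarrow> a \<oplus>\<^bsub>T\<^esub> b \<in> I" for a b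
    using assms unfolding gamma_ideal_iff by blast+
  show m: "\<lbrakk>a \<in> I; b \<in> carrier T\<rbrakk> \<Longrightarrow> a \<otimes>\<^bsub>T\<^esub> b \<in> I" for a b
    using assms unfolding gamma_ideal_iff by blast
  show "\<lbrakk>a \<in> I; b \<in> carrier T\<rbrakk> \<Longrightarrow> b \<otimes>\<^bsub>T\<^esub> a \<in> I"
    using m[of a b] m_comm[of a b] c(1) by simp
qed

lemma gamma_idealI:
  assumes "I \<subseteq> carrier T" "\<zero>\<^bsub>T\<^esub> \<in> I" "\<And>a b. \<lbrakk>a \<in> I; b \<in> I\<rbrakk> \<Longrightarrow> a \<oplus>\<^bsub>T\<^esub> b \<in> I"
    and "\<And>a b. \<lbrakk>a \<in> I; b \<in> carrier T\<rbrakk> \<Longrightarrow> a \<otimes>\<^bsub>T\<^esub> b \<in> I"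
  shows "gamma_ideal \<Gamma> T u I"
  using assms unfolding gamma_ideal_iff by blast

lemma gamma_ideal_Union_chain:
  assumes "\<C> \<noteq> {}" "\<And>I. I \<in> \<C> \<Longrightarrow> gamma_ideal \<Gamma> T u I"
    and chain: "\<And>I J. \<lbrakk>I \<in> \<C>; J \<in> \<C>\<rbrakk> \<Longrightarrow> I \<subseteq> J \<or> J \<subseteq> I"
  shows "gamma_ideal \<Gamma> T u (\<Union>\<C>)"
proof (rule gamma_idealI)
  show "\<Union>\<C> \<subseteq> carrier T" using assms(2) ideal_closed(1) by blast
  show "\<zero>\<^bsub>T\<^esub> \<in> \<Union>\<C>" using assms(1,2) ideal_closed(2) by blast
  fix a b assume a: "a \<in> \<Union>\<C>"
  then obtain I where I: "I \<in> \<C>" "a \<in> I" by blast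
  show "a \<otimes>\<^bsub>T\<^esub> b \<in> \<Union>\<C>" if "b \<in> carrier T"
    using that I assms(2) ideal_closed(4) by blast
  assume "b \<in> \<Union>\<C>"
  then obtain J where J: "J \<in> \<C>" "b \<in> J" by blast
  obtain K where "K \<in> \<C>" "a \<in> K" "b \<in> K" using chain[OF I(1) J(1)] I J by blast
  then show "a \<oplus>\<^bsub>T\<^esub> b \<in> \<Union>\<C>" using assms(2) ideal_closed(3) by blast
qed

lemma gamma_ideal_add_principal:
  assumes M: "gamma_ideal \<Gamma> T u M" and a: "a \<in> carrier T"
  shows "gamma_ideal \<Gamma> T u {m \<oplus>\<^bsub>T\<^esub> a \<otimes>\<^bsub>T\<^esub> x | m x. m \<in> M \<and> x \<in> carrier T}" (is "gamma_ideal \<Gamma> T u ?J")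
    and "M \<subseteq> {m \<oplus>\<^bsub>T\<^esub> a \<otimes>\<^bsub>T\<^esub> x | m x. m \<in> M \<and> x \<in> carrier T}"
    and "a \<in> {m \<oplus>\<^bsub>T\<^esub> a \<otimes>\<^bsub>T\<^esub> x | m x. m \<in> M \<and> x \<in> carrier T}"
proof -
  note [simp] = ideal_closed[OF M] a
  have memI: "m \<oplus>\<^bsub>T\<^esub> a \<otimes>\<^bsub>T\<^esub> x \<in> ?J" if "m \<in> M" "x \<in> carrier T" for m x using that by blast
  show "M \<subseteq> ?J"
  proof
    fix m assume "m \<in> M"
    then show "m \<in> ?J" using memI[of m "\<zero>\<^bsub>T\<^esub>"] by simp
  qed
  then have zero: "\<zero>\<^bsub>T\<^esub> \<in> ?J" using ideal_closed(2)[OF M] by (rule subsetD)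
  show "a \<in> ?J" using memI[of "\<zero>\<^bsub>T\<^esub>" "\<one>\<^bsub>T\<^esub>"] by simp
  show "gamma_ideal \<Gamma> T u ?J"
  proof (rule gamma_idealI)
    show "?J \<subseteq> carrier T" by auto
    show "\<zero>\<^bsub>T\<^esub> \<in> ?J" by (rule zero)
    fix c b assume "c \<in> ?J"
    then obtain m x where c: "c = m \<oplus>\<^bsub>T\<^esub> a \<otimes>\<^bsub>T\<^esub> x" "m \<in> M" "x \<in> carrier T" by blast
    show "c \<otimes>\<^bsub>T\<^esub> b \<in> ?J" if b: "b \<in> carrier T"
      using memI[of "m \<otimes>\<^bsub>T\<^esub> b" "x \<otimes>\<^bsub>T\<^esub> b"] c b by (simp add: l_distr m_assoc)
    assume "b \<in> ?J"
    then obtain n y where b: "b = n \<oplus>\<^bsub>T\<^esub> a \<otimes>\<^bsub>T\<^esub> y" "n \<in> M" "y \<in> carrier T" by blast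
    have "c \<oplus>\<^bsub>T\<^esub> b = (m \<oplus>\<^bsub>T\<^esub> n) \<oplus>\<^bsub>T\<^esub> a \<otimes>\<^bsub>T\<^esub> (x \<oplus>\<^bsub>T\<^esub> y)"
      using b c by (simp add: r_distr a_ac)
    then show "c \<oplus>\<^bsub>T\<^esub> b \<in> ?J" using memI[of "m \<oplus>\<^bsub>T\<^esub> n" "x \<oplus>\<^bsub>T\<^esub> y"] b c by simp
  qed
qed

lemma prime_avoiding_powers:
  assumes I: "gamma_ideal \<Gamma> T u I" and f: "f \<in> carrier T" and n: "\<And>n::nat. f [^]\<^bsub>T\<^esub> n \<notin> I"
  obtains P where "P \<in> Spec \<Gamma> T u" "I \<subseteq> P" "f \<notin> P"
proof -
  define \<A> where "\<A> = {J. gamma_ideal \<Gamma> T u J \<and> I \<subseteq> J \<and> (\<forall>n::nat. f [^]\<^bsub>T\<^esub> n \<notin> J)}"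
  have A_iff: "J \<in> \<A> \<longleftrightarrow> gamma_ideal \<Gamma> T u J \<and> I \<subseteq> J \<and> (\<forall>n::nat. f [^]\<^bsub>T\<^esub> n \<notin> J)" for J
    by (simp add: \<A>_def)
  have "\<exists>M\<in>\<A>. \<forall>X\<in>\<A>. M \<subseteq> X \<longrightarrow> X = M"
  proof (rule subset_Zorn_nonempty)
    show "\<A> \<noteq> {}" using I n A_iff[of I] by blast
    fix \<C> assume ne: "\<C> \<noteq> {}" and "subset.chain \<A> \<C>"
    then have sub: "\<C> \<subseteq> \<A>" and ch: "\<And>I J. \<lbrakk>I \<in> \<C>; J \<in> \<C>\<rbrakk> \<Longrightarrow> I \<subseteq> J \<or> J \<subseteq> I"
      by (auto simp: subset_chain_def)
    have "gamma_ideal \<Gamma> T u (\<Union>\<C>)"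
      by (rule gamma_ideal_Union_chain[OF ne _ ch]) (use sub A_iff in blast)
    moreover have "I \<subseteq> \<Union>\<C>" using sub ne A_iff by blast
    moreover have "f [^]\<^bsub>T\<^esub> (n::nat) \<notin> \<Union>\<C>" for n using sub A_iff by blast
    ultimately show "\<Union>\<C> \<in> \<A>" by (simp add: A_iff)
  qed
  then obtain M where MA: "M \<in> \<A>" and max: "\<And>J. \<lbrakk>J \<in> \<A>; M \<subseteq> J\<rbrakk> \<Longrightarrow> J = M" by blast
  have Mi: "gamma_ideal \<Gamma> T u M" and IM: "I \<subseteq> M" and pM: "\<And>n::nat. f [^]\<^bsub>T\<^esub> n \<notin> M"
    using MA by (auto simp: A_iff)
  note cl = ideal_closed[OF Mi]
  have ex: "\<exists>n::nat. \<exists>m\<in>M. \<exists>x\<in>carrier T. f [^]\<^bsub>T\<^esub> n = m \<oplus>\<^bsub>T\<^esub> a \<otimes>\<^bsub>T\<^esub> x"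
    if a: "a \<in> carrier T" "a \<notin> M" for a
  proof (rule ccontr)
    assume no: "\<not> ?thesis"
    let ?J = "{m \<oplus>\<^bsub>T\<^esub> a \<otimes>\<^bsub>T\<^esub> x | m x. m \<in> M \<and> x \<in> carrier T}"
    have "f [^]\<^bsub>T\<^esub> (n::nat) \<notin> ?J" for n using no by blast
    moreover have "I \<subseteq> ?J" using gamma_ideal_add_principal(2)[OF Mi a(1)] IM by (rule order_trans[rotated])
    ultimately have "?J \<in> \<A>" using gamma_ideal_add_principal(1)[OF Mi a(1)] unfolding A_iff by blast
    then have "?J = M" using gamma_ideal_add_principal(2)[OF Mi a(1)] by (rule max)
    then show False using gamma_ideal_add_principal(3)[OF Mi a(1)] a(2) by blast
  qed
  have "a \<in> M \<or> b \<in> M" if ab: "a \<in> carrier T" "b \<in> carrier T" "a \<otimes>\<^bsub>T\<^esub> b \<in> M" for a b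
  proof (rule ccontr)
    assume "\<not> ?thesis"
    then have "a \<notin> M" "b \<notin> M" by auto
    obtain n m x where p: "f [^]\<^bsub>T\<^esub> (n::nat) = m \<oplus>\<^bsub>T\<^esub> a \<otimes>\<^bsub>T\<^esub> x" "m \<in> M" "x \<in> carrier T"
      using ex[OF ab(1) \<open>a \<notin> M\<close>] by blast
    obtain k q y where q: "f [^]\<^bsub>T\<^esub> (k::nat) = q \<oplus>\<^bsub>T\<^esub> b \<otimes>\<^bsub>T\<^esub> y" "q \<in> M" "y \<in> carrier T"
      using ex[OF ab(2) \<open>b \<notin> M\<close>] by blast
    have "f [^]\<^bsub>T\<^esub> (n + k) = (m \<oplus>\<^bsub>T\<^esub> a \<otimes>\<^bsub>T\<^esub> x) \<otimes>\<^bsub>T\<^esub> (q \<oplus>\<^bsub>T\<^esub> b \<otimes>\<^bsub>T\<^esub> y)"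
      using nat_pow_mult[OF f, of n k] p q by simp
    also have "\<dots> = m \<otimes>\<^bsub>T\<^esub> (q \<oplus>\<^bsub>T\<^esub> b \<otimes>\<^bsub>T\<^esub> y) \<oplus>\<^bsub>T\<^esub>
        ((a \<otimes>\<^bsub>T\<^esub> x) \<otimes>\<^bsub>T\<^esub> q \<oplus>\<^bsub>T\<^esub> (a \<otimes>\<^bsub>T\<^esub> x) \<otimes>\<^bsub>T\<^esub> (b \<otimes>\<^bsub>T\<^esub> y))"
      using p q ab cl(1)
      by (simp add: l_distr r_distr[of q "b \<otimes>\<^bsub>T\<^esub> y" "a \<otimes>\<^bsub>T\<^esub> x"])
    also have "(a \<otimes>\<^bsub>T\<^esub> x) \<otimes>\<^bsub>T\<^esub> (b \<otimes>\<^bsub>T\<^esub> y) = (a \<otimes>\<^bsub>T\<^esub> b) \<otimes>\<^bsub>T\<^esub> (x \<otimes>\<^bsub>T\<^esub> y)"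
      using p q ab by (simp add: m_ac)
    also have "m \<otimes>\<^bsub>T\<^esub> (q \<oplus>\<^bsub>T\<^esub> b \<otimes>\<^bsub>T\<^esub> y) \<oplus>\<^bsub>T\<^esub>
        ((a \<otimes>\<^bsub>T\<^esub> x) \<otimes>\<^bsub>T\<^esub> q \<oplus>\<^bsub>T\<^esub> (a \<otimes>\<^bsub>T\<^esub> b) \<otimes>\<^bsub>T\<^esub> (x \<otimes>\<^bsub>T\<^esub> y)) \<in> M"
      by (intro cl(3) cl(4)[OF p(2)] cl(5)[OF q(2)] cl(4)[OF ab(3)]) (use p q ab cl(1) in simp_all)
    finally show False using pM by blast
  qed
  moreover have "\<one>\<^bsub>T\<^esub> \<notin> M" using pM[of 0] by simp
  ultimately have "M \<in> Spec \<Gamma> T u" using Mi unfolding Spec_iff by blast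
  moreover have "f \<notin> M" using pM[of 1] f by simp
  ultimately show ?thesis using IM by (intro that[of M]) auto
qed

lemma radical:
  assumes "gamma_ideal \<Gamma> T u I" "f \<in> carrier T"
    and "\<And>P. \<lbrakk>P \<in> Spec \<Gamma> T u; I \<subseteq> P\<rbrakk> \<Longrightarrow> f \<in> P"
  obtains n :: nat where "f [^]\<^bsub>T\<^esub> n \<in> I"
  using prime_avoiding_powers[OF assms(1,2)] assms(3) by metis

text \<open>Sections are realized as functions into the localizations at the primes which are
  locally given by a fraction.\<close>

definition compl :: "'a set \<Rightarrow> 'a set" where
  "compl P = carrier T - P"

abbreviation loc_prime :: "'a set \<Rightarrow> ('a \<times> 'a) set ring" where
  "loc_prime P \<equiv> localization T (compl P)"

abbreviation D :: "'a \<Rightarrow> 'a set set" where "D f \<equiv> D_Spec \<Gamma> T u f"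

abbreviation frc :: "'a set \<Rightarrow> 'a \<Rightarrow> 'a \<Rightarrow> ('a \<times> 'a) set" where
  "frc Q a s \<equiv> fraction T (compl Q) a s"

definition secs :: "'a set set \<Rightarrow> ('a set \<Rightarrow> ('a \<times> 'a) set) set" where
  "secs U = {s \<in> extensional U. \<forall>P\<in>U. \<exists>a\<in>carrier T. \<exists>f\<in>carrier T.
     P \<in> D f \<and> D f \<subseteq> U \<and> (\<forall>Q\<in>D f. s Q = frc Q a f)}"

definition sec_ring :: "'a set set \<Rightarrow> ('a set \<Rightarrow> ('a \<times> 'a) set) ring" where
  "sec_ring U = \<lparr>carrier = secs U,
     mult = (\<lambda>s t. \<lambda>P\<in>U. s P \<otimes>\<^bsub>loc_prime P\<^esub> t P), one = (\<lambda>P\<in>U. \<one>\<^bsub>loc_prime P\<^esub>),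
     zero = (\<lambda>P\<in>U. \<zero>\<^bsub>loc_prime P\<^esub>), add = (\<lambda>s t. \<lambda>P\<in>U. s P \<oplus>\<^bsub>loc_prime P\<^esub> t P)\<rparr>"

lemma sec_ring_simps [simp]:
  "carrier (sec_ring U) = secs U"
  "s \<otimes>\<^bsub>sec_ring U\<^esub> t = (\<lambda>P\<in>U. s P \<otimes>\<^bsub>loc_prime P\<^esub> t P)"
  "s \<oplus>\<^bsub>sec_ring U\<^esub> t = (\<lambda>P\<in>U. s P \<oplus>\<^bsub>loc_prime P\<^esub> t P)"
  "\<one>\<^bsub>sec_ring U\<^esub> = (\<lambda>P\<in>U. \<one>\<^bsub>loc_prime P\<^esub>)"
  "\<zero>\<^bsub>sec_ring U\<^esub> = (\<lambda>P\<in>U. \<zero>\<^bsub>loc_prime P\<^esub>)"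
  by (simp_all add: sec_ring_def)

lemma submonoid_compl: "P \<in> Spec \<Gamma> T u \<Longrightarrow> submonoid (compl P) T"
  unfolding Spec_iff compl_def by unfold_locales auto

lemma D_compl: "\<lbrakk>Q \<in> D f; f \<in> carrier T\<rbrakk> \<Longrightarrow> f \<in> compl Q"
  by (simp add: D_Spec_def compl_def)

lemma D_Spec_Spec: "Q \<in> D f \<Longrightarrow> Q \<in> Spec \<Gamma> T u"
  by (simp add: D_Spec_def)

lemma compl_pow: "\<lbrakk>Q \<in> Spec \<Gamma> T u; f \<in> compl Q\<rbrakk> \<Longrightarrow> f [^]\<^bsub>T\<^esub> (n::nat) \<in> compl Q"
  using submonoid.one_closed[OF submonoid_compl] submonoid.m_closed[OF submonoid_compl]
  by (induction n) auto

lemma powers_compl: "\<lbrakk>Q \<in> D f; f \<in> carrier T\<rbrakk> \<Longrightarrow> powers T f \<subseteq> compl Q"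
  using compl_pow D_compl D_Spec_Spec by (auto simp: powers_def)

lemma eq_on_D:
  assumes f: "f \<in> carrier T" and c: "a \<in> carrier T" "b \<in> carrier T" "s \<in> powers T f" "t \<in> powers T f"
    and eq: "\<And>Q. Q \<in> D f \<Longrightarrow> frc Q a s = frc Q b t"
  shows "fraction T (powers T f) a s = fraction T (powers T f) b t"
proof -
  note p = submonoid_powers[OF f]
  have st [simp]: "s \<in> carrier T" "t \<in> carrier T" using S_carrier[OF p] c by auto
  let ?J = "{w \<in> carrier T. w \<otimes>\<^bsub>T\<^esub> a \<otimes>\<^bsub>T\<^esub> t = w \<otimes>\<^bsub>T\<^esub> b \<otimes>\<^bsub>T\<^esub> s}"
  have J: "gamma_ideal \<Gamma> T u ?J"
  proof (rule gamma_idealI)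
    fix x y assume x: "x \<in> ?J"
    show "x \<oplus>\<^bsub>T\<^esub> y \<in> ?J" if "y \<in> ?J" using x that c by (simp add: l_distr)
    show "x \<otimes>\<^bsub>T\<^esub> y \<in> ?J" if y: "y \<in> carrier T"
    proof -
      have "x \<otimes>\<^bsub>T\<^esub> y \<otimes>\<^bsub>T\<^esub> a \<otimes>\<^bsub>T\<^esub> t = y \<otimes>\<^bsub>T\<^esub> (x \<otimes>\<^bsub>T\<^esub> a \<otimes>\<^bsub>T\<^esub> t)" using x y c by (simp add: m_ac)
      also have "\<dots> = y \<otimes>\<^bsub>T\<^esub> (x \<otimes>\<^bsub>T\<^esub> b \<otimes>\<^bsub>T\<^esub> s)" using x by simp
      also have "\<dots> = x \<otimes>\<^bsub>T\<^esub> y \<otimes>\<^bsub>T\<^esub> b \<otimes>\<^bsub>T\<^esub> s" using x y c by (simp add: m_ac)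
      finally show ?thesis using x y by simp
    qed
  qed (use c in auto)
  have inP: "f \<in> P" if P: "P \<in> Spec \<Gamma> T u" "?J \<subseteq> P" for P
  proof (rule ccontr)
    assume "f \<notin> P"
    then have D: "P \<in> D f" using P by (simp add: D_Spec_def)
    have "s \<in> compl P" "t \<in> compl P" using powers_compl[OF D f] c by auto
    then obtain w where "w \<in> compl P" "w \<otimes>\<^bsub>T\<^esub> a \<otimes>\<^bsub>T\<^esub> t = w \<otimes>\<^bsub>T\<^esub> b \<otimes>\<^bsub>T\<^esub> s"
      using eq[OF D] frac_eq_iff[OF submonoid_compl[OF P(1)]] c by auto
    then show False using P(2) by (auto simp: compl_def)
  qed
  obtain n :: nat where "f [^]\<^bsub>T\<^esub> n \<in> ?J" by (rule radical[OF J f inP])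
  moreover have "f [^]\<^bsub>T\<^esub> n \<in> powers T f" by (auto simp: powers_def)
  ultimately show ?thesis using c by (subst frac_eq_iff[OF p]) auto
qed

lemma frc_cancel:
  assumes "Q \<in> Spec \<Gamma> T u" "a \<in> carrier T" "s \<in> compl Q" "t \<in> compl Q"
  shows "frc Q (a \<otimes>\<^bsub>T\<^esub> t) (s \<otimes>\<^bsub>T\<^esub> t) = frc Q a s"
proof -
  note S = submonoid_compl[OF assms(1)]
  show ?thesis
    using assms S_carrier[OF S] S_mult[OF S] by (intro frac_eqI[OF S]) (auto simp: m_ac)
qed

lemma finite_cover:
  assumes f: "f \<in> carrier T" and H: "H \<subseteq> carrier T" and cov: "\<And>Q. Q \<in> D f \<Longrightarrow> \<exists>h\<in>H. Q \<in> D h"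
  obtains F where "finite F" "F \<subseteq> H" "\<forall>Q\<in>D f. \<exists>h\<in>F. Q \<in> D h"
proof -
  let ?G = "\<lambda>F x. \<forall>I. gamma_ideal \<Gamma> T u I \<and> F \<subseteq> I \<longrightarrow> x \<in> I"
  let ?J = "{x \<in> carrier T. \<exists>F. finite F \<and> F \<subseteq> H \<and> ?G F x}"
  have J: "gamma_ideal \<Gamma> T u ?J"
  proof (rule gamma_idealI)
    show "?J \<subseteq> carrier T" by blast
    show "\<zero>\<^bsub>T\<^esub> \<in> ?J" using ideal_closed(2) by (auto intro!: exI[of _ "{}"])
    fix x y assume "x \<in> ?J"
    then obtain F where F: "x \<in> carrier T" "finite F" "F \<subseteq> H" "?G F x" by blast
    show "x \<otimes>\<^bsub>T\<^esub> y \<in> ?J" if "y \<in> carrier T"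
      using that F ideal_closed(4) by (auto intro!: exI[of _ F])
    assume "y \<in> ?J"
    then obtain G where G: "y \<in> carrier T" "finite G" "G \<subseteq> H" "?G G y" by blast
    show "x \<oplus>\<^bsub>T\<^esub> y \<in> ?J"
      using F G ideal_closed(3) by (auto intro!: exI[of _ "F \<union> G"])
  qed
  have inP: "f \<in> P" if P: "P \<in> Spec \<Gamma> T u" "?J \<subseteq> P" for P
  proof (rule ccontr)
    assume "f \<notin> P"
    then have "P \<in> D f" using P by (simp add: D_Spec_def)
    then obtain h where h: "h \<in> H" "P \<in> D h" using cov by blast
    then have "h \<in> ?J" using H by (auto intro!: exI[of _ "{h}"])
    then show False using P(2) h by (auto simp: D_Spec_def)
  qed
  obtain k :: nat where "f [^]\<^bsub>T\<^esub> k \<in> ?J" by (rule radical[OF J f inP])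
  then obtain F where F: "finite F" "F \<subseteq> H" "?G F (f [^]\<^bsub>T\<^esub> k)" by blast
  show ?thesis
  proof (rule that[OF F(1,2)], rule ballI)
    fix Q assume Q: "Q \<in> D f"
    have QS: "Q \<in> Spec \<Gamma> T u" using Q by (rule D_Spec_Spec)
    have "f [^]\<^bsub>T\<^esub> k \<notin> Q" using compl_pow[OF QS D_compl[OF Q f]] by (auto simp: compl_def)
    moreover have "gamma_ideal \<Gamma> T u Q" using QS unfolding Spec_iff by blast
    ultimately have "\<not> F \<subseteq> Q" using F(3) by blast
    then show "\<exists>h\<in>F. Q \<in> D h" using QS by (auto simp: D_Spec_def)
  qed
qed

lemma secs_D:
  assumes f: "f \<in> carrier T" and s: "s \<in> secs (D f)"
  obtains a t where "a \<in> carrier T" "t \<in> powers T f" "\<forall>Q\<in>D f. s Q = frc Q a t"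
proof -
  let ?H = "{h \<in> carrier T. D h \<subseteq> D f \<and> (\<exists>a\<in>carrier T. \<forall>Q\<in>D h. s Q = frc Q a h)}"
  have cov: "\<exists>h\<in>?H. Q \<in> D h" if Q: "Q \<in> D f" for Q
  proof -
    have "\<exists>a\<in>carrier T. \<exists>h\<in>carrier T. Q \<in> D h \<and> D h \<subseteq> D f \<and> (\<forall>Q\<in>D h. s Q = frc Q a h)"
      using s Q by (simp add: secs_def)
    then show ?thesis by blast
  qed
  have HT: "?H \<subseteq> carrier T" by blast
  obtain F where F: "finite F" "F \<subseteq> ?H" and Fcov: "\<forall>Q\<in>D f. \<exists>h\<in>F. Q \<in> D h"
    by (rule finite_cover[OF f HT cov])
  have "\<forall>h\<in>F. \<exists>a. a \<in> carrier T \<and> (\<forall>Q\<in>D h. s Q = frc Q a h)" using F(2) by blast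
  then obtain A where "\<forall>h\<in>F. A h \<in> carrier T \<and> (\<forall>Q\<in>D h. s Q = frc Q (A h) h)"
    by (rule bchoice[THEN exE])
  then have A: "A h \<in> carrier T" "Q \<in> D h \<Longrightarrow> s Q = frc Q (A h) h" if "h \<in> F" for h Q
    using that by blast+
  have FT: "h \<in> carrier T" if "h \<in> F" for h using F(2) that by blast
  have "\<exists>n::nat. (h \<otimes>\<^bsub>T\<^esub> g) [^]\<^bsub>T\<^esub> n \<otimes>\<^bsub>T\<^esub> (A h \<otimes>\<^bsub>T\<^esub> g) = (h \<otimes>\<^bsub>T\<^esub> g) [^]\<^bsub>T\<^esub> n \<otimes>\<^bsub>T\<^esub> (A g \<otimes>\<^bsub>T\<^esub> h)"
    if h: "h \<in> F" and g: "g \<in> F" for h g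
  proof -
    note [simp] = FT[OF h] FT[OF g] A(1)[OF h] A(1)[OF g]
    define e where "e = h \<otimes>\<^bsub>T\<^esub> g"
    have e: "e \<in> carrier T" by (simp add: e_def)
    have "e [^]\<^bsub>T\<^esub> (1::nat) \<in> powers T e" unfolding powers_def by blast
    then have ep: "e \<in> powers T e" using e by simp
    have "fraction T (powers T e) (A h \<otimes>\<^bsub>T\<^esub> g) e = fraction T (powers T e) (A g \<otimes>\<^bsub>T\<^esub> h) e"
    proof (rule eq_on_D[OF e _ _ ep ep])
      fix Q assume "Q \<in> D e"
      then have Q: "Q \<in> D h" "Q \<in> D g" by (simp_all add: e_def D_Spec_mult)
      then have hg: "h \<in> compl Q" "g \<in> compl Q" by (simp_all add: D_compl)
      have "frc Q (A h \<otimes>\<^bsub>T\<^esub> g) e = s Q"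
        using frc_cancel[OF D_Spec_Spec[OF Q(1)] A(1)[OF h] hg] A(2)[OF h Q(1)] by (simp add: e_def)
      moreover have "frc Q (A g \<otimes>\<^bsub>T\<^esub> h) e = s Q"
        using frc_cancel[OF D_Spec_Spec[OF Q(1)] A(1)[OF g] hg(2,1)] A(2)[OF g Q(2)]
        by (simp add: e_def m_comm)
      ultimately show "frc Q (A h \<otimes>\<^bsub>T\<^esub> g) e = frc Q (A g \<otimes>\<^bsub>T\<^esub> h) e" by simp
    qed auto
    then obtain w where w: "w \<in> powers T e" "w \<otimes>\<^bsub>T\<^esub> (A h \<otimes>\<^bsub>T\<^esub> g) \<otimes>\<^bsub>T\<^esub> e = w \<otimes>\<^bsub>T\<^esub> (A g \<otimes>\<^bsub>T\<^esub> h) \<otimes>\<^bsub>T\<^esub> e"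
      using frac_eq_iff[OF submonoid_powers[OF e] _ _ ep ep] by auto
    then obtain n :: nat where n: "w = e [^]\<^bsub>T\<^esub> n" by (auto simp: powers_def)
    have "e [^]\<^bsub>T\<^esub> Suc n \<otimes>\<^bsub>T\<^esub> x = w \<otimes>\<^bsub>T\<^esub> x \<otimes>\<^bsub>T\<^esub> e" if "x \<in> carrier T" for x
      using that e n by (simp add: m_ac)
    then have "e [^]\<^bsub>T\<^esub> Suc n \<otimes>\<^bsub>T\<^esub> (A h \<otimes>\<^bsub>T\<^esub> g) = e [^]\<^bsub>T\<^esub> Suc n \<otimes>\<^bsub>T\<^esub> (A g \<otimes>\<^bsub>T\<^esub> h)"
      using w(2) by simp
    then show ?thesis unfolding e_def by blast
  qed
  then obtain n :: "'a \<Rightarrow> 'a \<Rightarrow> nat" where n: "\<And>h g. \<lbrakk>h \<in> F; g \<in> F\<rbrakk> \<Longrightarrow>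
      (h \<otimes>\<^bsub>T\<^esub> g) [^]\<^bsub>T\<^esub> n h g \<otimes>\<^bsub>T\<^esub> (A h \<otimes>\<^bsub>T\<^esub> g) = (h \<otimes>\<^bsub>T\<^esub> g) [^]\<^bsub>T\<^esub> n h g \<otimes>\<^bsub>T\<^esub> (A g \<otimes>\<^bsub>T\<^esub> h)"
    by metis
  define N where "N = (\<Sum>h\<in>F. \<Sum>g\<in>F. n h g)"
  have nN: "n h g \<le> N" if "h \<in> F" "g \<in> F" for h g
  proof -
    have "n h g \<le> (\<Sum>g\<in>F. n h g)" using that F(1) by (intro member_le_sum) auto
    also have "\<dots> \<le> N" unfolding N_def using that F(1) by (intro member_le_sum) auto
    finally show ?thesis .
  qed
  have N: "(h \<otimes>\<^bsub>T\<^esub> g) [^]\<^bsub>T\<^esub> N \<otimes>\<^bsub>T\<^esub> (A h \<otimes>\<^bsub>T\<^esub> g) = (h \<otimes>\<^bsub>T\<^esub> g) [^]\<^bsub>T\<^esub> N \<otimes>\<^bsub>T\<^esub> (A g \<otimes>\<^bsub>T\<^esub> h)"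
    if h: "h \<in> F" and g: "g \<in> F" for h g
  proof -
    note [simp] = FT[OF h] FT[OF g] A(1)[OF h] A(1)[OF g]
    have "(h \<otimes>\<^bsub>T\<^esub> g) [^]\<^bsub>T\<^esub> N = (h \<otimes>\<^bsub>T\<^esub> g) [^]\<^bsub>T\<^esub> (N - n h g) \<otimes>\<^bsub>T\<^esub> (h \<otimes>\<^bsub>T\<^esub> g) [^]\<^bsub>T\<^esub> n h g"
      using nN[OF h g] by (subst nat_pow_mult) auto
    then show ?thesis using n[OF h g] by (simp add: m_assoc)
  qed
  define H' where "H' h = h [^]\<^bsub>T\<^esub> Suc N" for h
  define A' where "A' h = A h \<otimes>\<^bsub>T\<^esub> h [^]\<^bsub>T\<^esub> N" for h
  have H'T [simp]: "H' h \<in> carrier T" and A'T [simp]: "A' h \<in> carrier T" if "h \<in> F" for h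
    using FT[OF that] A(1)[OF that] by (simp_all add: H'_def A'_def)
  have comp: "H' h \<otimes>\<^bsub>T\<^esub> A' g = H' g \<otimes>\<^bsub>T\<^esub> A' h" if h: "h \<in> F" and g: "g \<in> F" for h g
  proof -
    note [simp] = FT[OF h] FT[OF g] A(1)[OF h] A(1)[OF g]
    have "H' h \<otimes>\<^bsub>T\<^esub> A' g = (h [^]\<^bsub>T\<^esub> N \<otimes>\<^bsub>T\<^esub> g [^]\<^bsub>T\<^esub> N) \<otimes>\<^bsub>T\<^esub> (A g \<otimes>\<^bsub>T\<^esub> h)"
      by (simp add: H'_def A'_def m_ac)
    also have "\<dots> = (h \<otimes>\<^bsub>T\<^esub> g) [^]\<^bsub>T\<^esub> N \<otimes>\<^bsub>T\<^esub> (A g \<otimes>\<^bsub>T\<^esub> h)"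
      by (simp add: nat_pow_distrib)
    also have "\<dots> = (h \<otimes>\<^bsub>T\<^esub> g) [^]\<^bsub>T\<^esub> N \<otimes>\<^bsub>T\<^esub> (A h \<otimes>\<^bsub>T\<^esub> g)" using N[OF h g] by simp
    also have "\<dots> = (h [^]\<^bsub>T\<^esub> N \<otimes>\<^bsub>T\<^esub> g [^]\<^bsub>T\<^esub> N) \<otimes>\<^bsub>T\<^esub> (A h \<otimes>\<^bsub>T\<^esub> g)"
      by (simp add: nat_pow_distrib)
    also have "\<dots> = H' g \<otimes>\<^bsub>T\<^esub> A' h"
      by (simp add: H'_def A'_def m_ac)
    finally show ?thesis .
  qed
  let ?J = "{x \<in> carrier T. \<exists>y\<in>carrier T. \<forall>h\<in>F. H' h \<otimes>\<^bsub>T\<^esub> y = x \<otimes>\<^bsub>T\<^esub> A' h}"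
  have J: "gamma_ideal \<Gamma> T u ?J"
  proof (rule gamma_idealI)
    show "?J \<subseteq> carrier T" by blast
    show "\<zero>\<^bsub>T\<^esub> \<in> ?J" by (auto intro!: bexI[of _ "\<zero>\<^bsub>T\<^esub>"])
    fix x x' assume "x \<in> ?J"
    then obtain y where y: "x \<in> carrier T" "y \<in> carrier T" "\<forall>h\<in>F. H' h \<otimes>\<^bsub>T\<^esub> y = x \<otimes>\<^bsub>T\<^esub> A' h" by blast
    show "x \<otimes>\<^bsub>T\<^esub> x' \<in> ?J" if x': "x' \<in> carrier T"
    proof -
      have "H' h \<otimes>\<^bsub>T\<^esub> (y \<otimes>\<^bsub>T\<^esub> x') = x \<otimes>\<^bsub>T\<^esub> x' \<otimes>\<^bsub>T\<^esub> A' h" if h: "h \<in> F" for h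
      proof -
        have "H' h \<otimes>\<^bsub>T\<^esub> (y \<otimes>\<^bsub>T\<^esub> x') = (H' h \<otimes>\<^bsub>T\<^esub> y) \<otimes>\<^bsub>T\<^esub> x'"
          by (rule m_assoc[symmetric]) (use y x' h in auto)
        also have "\<dots> = (x \<otimes>\<^bsub>T\<^esub> A' h) \<otimes>\<^bsub>T\<^esub> x'" using y h by simp
        also have "\<dots> = x \<otimes>\<^bsub>T\<^esub> x' \<otimes>\<^bsub>T\<^esub> A' h" using y x' h by (simp add: m_ac)
        finally show ?thesis .
      qed
      then show ?thesis using y x' by (auto intro!: bexI[of _ "y \<otimes>\<^bsub>T\<^esub> x'"])
    qed
    assume "x' \<in> ?J"
    then obtain y' where y': "x' \<in> carrier T" "y' \<in> carrier T" "\<forall>h\<in>F. H' h \<otimes>\<^bsub>T\<^esub> y' = x' \<otimes>\<^bsub>T\<^esub> A' h" by blast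
    have "\<forall>h\<in>F. H' h \<otimes>\<^bsub>T\<^esub> (y \<oplus>\<^bsub>T\<^esub> y') = (x \<oplus>\<^bsub>T\<^esub> x') \<otimes>\<^bsub>T\<^esub> A' h"
      using y y' by (simp add: l_distr r_distr)
    then show "x \<oplus>\<^bsub>T\<^esub> x' \<in> ?J" using y y' by (auto intro!: bexI[of _ "y \<oplus>\<^bsub>T\<^esub> y'"])
  qed
  have inP: "f \<in> P" if P: "P \<in> Spec \<Gamma> T u" "?J \<subseteq> P" for P
  proof (rule ccontr)
    assume "f \<notin> P"
    then have "P \<in> D f" using P by (simp add: D_Spec_def)
    then obtain h where h: "h \<in> F" "P \<in> D h" using Fcov by blast
    have "H' h \<in> compl P" unfolding H'_def using compl_pow[OF P(1) D_compl[OF h(2) FT[OF h(1)]]] .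
    moreover have "H' h \<in> ?J" using h comp by (auto intro!: bexI[of _ "A' h"])
    ultimately show False using P(2) by (auto simp: compl_def)
  qed
  obtain k :: nat where "f [^]\<^bsub>T\<^esub> k \<in> ?J" by (rule radical[OF J f inP])
  then obtain y where y: "y \<in> carrier T" "\<forall>h\<in>F. H' h \<otimes>\<^bsub>T\<^esub> y = f [^]\<^bsub>T\<^esub> k \<otimes>\<^bsub>T\<^esub> A' h" by blast
  show ?thesis
  proof (rule that[OF y(1)], rule_tac [2] ballI)
    show "f [^]\<^bsub>T\<^esub> k \<in> powers T f" by (auto simp: powers_def)
    fix Q assume Q: "Q \<in> D f"
    then obtain h where h: "h \<in> F" "Q \<in> D h" using Fcov by blast
    have QS: "Q \<in> Spec \<Gamma> T u" using Q by (rule D_Spec_Spec)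
    note S = submonoid_compl[OF QS]
    have hQ: "h \<in> compl Q" and fQ: "f \<in> compl Q" using D_compl h Q f FT by auto
    have "s Q = frc Q (A h) h" using A(2) h by blast
    also have "\<dots> = frc Q (A' h) (h \<otimes>\<^bsub>T\<^esub> h [^]\<^bsub>T\<^esub> N)"
      unfolding A'_def using frc_cancel[OF QS A(1)[OF h(1)] hQ compl_pow[OF QS hQ]] by simp
    also have "h \<otimes>\<^bsub>T\<^esub> h [^]\<^bsub>T\<^esub> N = H' h" using FT[OF h(1)] by (simp add: H'_def m_comm)
    also have "frc Q (A' h) (H' h) = frc Q y (f [^]\<^bsub>T\<^esub> k)"
    proof (rule frac_eqI[OF S])
      show "A' h \<otimes>\<^bsub>T\<^esub> f [^]\<^bsub>T\<^esub> k = y \<otimes>\<^bsub>T\<^esub> H' h"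
        using y h f m_comm[of "A' h" "f [^]\<^bsub>T\<^esub> k"] m_comm[of y "H' h"] by simp
      show "H' h \<in> compl Q" unfolding H'_def using compl_pow[OF QS hQ] .
    qed (use y h compl_pow[OF QS fQ] in auto)
    finally show "s Q = frc Q y (f [^]\<^bsub>T\<^esub> k)" .
  qed
qed

end

context ternary_gamma_semiring
begin

lemma secsI:
  assumes "s \<in> extensional U"
    and "\<And>P. P \<in> U \<Longrightarrow> \<exists>a\<in>carrier T. \<exists>f\<in>carrier T. P \<in> D f \<and> D f \<subseteq> U \<and> (\<forall>Q\<in>D f. s Q = frc Q a f)"
  shows "s \<in> secs U"
  using assms by (simp add: secs_def)

lemma secsE:
  assumes "s \<in> secs U" "P \<in> U"
  obtains a f where "a \<in> carrier T" "f \<in> carrier T" "P \<in> D f" "D f \<subseteq> U"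
    "\<forall>Q\<in>D f. s Q = frc Q a f"
proof -
  have "\<exists>a\<in>carrier T. \<exists>f\<in>carrier T. P \<in> D f \<and> D f \<subseteq> U \<and> (\<forall>Q\<in>D f. s Q = frc Q a f)"
    using assms by (simp add: secs_def)
  then show ?thesis using that by blast
qed

lemma secs_ext: "s \<in> secs U \<Longrightarrow> s \<in> extensional U"
  by (simp add: secs_def)

lemma secs_eqI:
  "\<lbrakk>s \<in> secs U; t \<in> secs U; \<And>P. P \<in> U \<Longrightarrow> s P = t P\<rbrakk> \<Longrightarrow> s = t"
  by (meson extensionalityI secs_ext)

lemma secs_val:
  assumes "s \<in> secs U" "P \<in> U"
  shows "s P \<in> carrier (loc_prime P)"
  using assms(1,2)
proof (rule secsE)
  fix a f assume "a \<in> carrier T" "f \<in> carrier T" "P \<in> D f" "\<forall>Q\<in>D f. s Q = frc Q a f"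
  then show ?thesis using frac_carrier[OF submonoid_compl] D_Spec_Spec D_compl by metis
qed

lemma comm_semiring_loc_prime: "P \<in> Spec \<Gamma> T u \<Longrightarrow> comm_semiring (loc_prime P)"
  by (rule comm_semiring_localization[OF submonoid_compl])

lemma open_Spec: "\<lbrakk>openin (Spec_top \<Gamma> T u) U; P \<in> U\<rbrakk> \<Longrightarrow> P \<in> Spec \<Gamma> T u"
  using openin_subset topspace_Spec by blast

lemma secs_const:
  assumes U: "openin (Spec_top \<Gamma> T u) U" and a: "a \<in> carrier T"
  shows "(\<lambda>P\<in>U. frc P a \<one>\<^bsub>T\<^esub>) \<in> secs U"
proof (rule secsI)
  fix P assume P: "P \<in> U"
  obtain f where f: "f \<in> carrier T" "P \<in> D f" "D f \<subseteq> U" by (rule D_Spec_basis[OF U P])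
  have "(\<lambda>P\<in>U. frc P a \<one>\<^bsub>T\<^esub>) Q = frc Q (a \<otimes>\<^bsub>T\<^esub> f) f" if Q: "Q \<in> D f" for Q
  proof -
    have S: "submonoid (compl Q) T" using submonoid_compl D_Spec_Spec[OF Q] .
    have "frc Q a \<one>\<^bsub>T\<^esub> = frc Q (a \<otimes>\<^bsub>T\<^esub> f) f"
      using a f D_compl[OF Q] S_one[OF S] by (intro frac_eqI[OF S]) auto
    then show ?thesis using Q f by auto
  qed
  then show "\<exists>a'\<in>carrier T. \<exists>f\<in>carrier T. P \<in> D f \<and> D f \<subseteq> U \<and>
      (\<forall>Q\<in>D f. (\<lambda>P\<in>U. frc P a \<one>\<^bsub>T\<^esub>) Q = frc Q a' f)"
    using f a by (intro bexI[of _ "a \<otimes>\<^bsub>T\<^esub> f"] bexI[of _ f]) auto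
qed auto

lemma secs_one: "openin (Spec_top \<Gamma> T u) U \<Longrightarrow> (\<lambda>P\<in>U. \<one>\<^bsub>loc_prime P\<^esub>) \<in> secs U"
  using secs_const[OF _ one_closed] by (simp add: localization_def)

lemma secs_zero: "openin (Spec_top \<Gamma> T u) U \<Longrightarrow> (\<lambda>P\<in>U. \<zero>\<^bsub>loc_prime P\<^esub>) \<in> secs U"
  using secs_const[OF _ zero_closed] by (simp add: localization_def)

lemma secs_mult_add:
  assumes s: "s \<in> secs U" and t: "t \<in> secs U"
  shows "(\<lambda>P\<in>U. s P \<otimes>\<^bsub>loc_prime P\<^esub> t P) \<in> secs U" (is "?m \<in> _")
    and "(\<lambda>P\<in>U. s P \<oplus>\<^bsub>loc_prime P\<^esub> t P) \<in> secs U" (is "?p \<in> _")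
proof -
  have *: "\<exists>a\<in>carrier T. \<exists>b\<in>carrier T. \<exists>h\<in>carrier T. P \<in> D h \<and> D h \<subseteq> U \<and>
      (\<forall>Q\<in>D h. ?m Q = frc Q a h) \<and> (\<forall>Q\<in>D h. ?p Q = frc Q b h)" if P: "P \<in> U" for P
  proof -
    obtain a f where a: "a \<in> carrier T" "f \<in> carrier T" "P \<in> D f" "D f \<subseteq> U"
      "\<forall>Q\<in>D f. s Q = frc Q a f" by (rule secsE[OF s P])
    obtain b g where b: "b \<in> carrier T" "g \<in> carrier T" "P \<in> D g" "D g \<subseteq> U"
      "\<forall>Q\<in>D g. t Q = frc Q b g" by (rule secsE[OF t P])
    have fg: "D (f \<otimes>\<^bsub>T\<^esub> g) = D f \<inter> D g" using a b by (simp add: D_Spec_mult)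
    have "?m Q = frc Q (a \<otimes>\<^bsub>T\<^esub> b) (f \<otimes>\<^bsub>T\<^esub> g)"
      "?p Q = frc Q (a \<otimes>\<^bsub>T\<^esub> g \<oplus>\<^bsub>T\<^esub> b \<otimes>\<^bsub>T\<^esub> f) (f \<otimes>\<^bsub>T\<^esub> g)" if Q: "Q \<in> D (f \<otimes>\<^bsub>T\<^esub> g)" for Q
    proof -
      have Q': "Q \<in> D f" "Q \<in> D g" "Q \<in> U" using Q a(4) unfolding fg by auto
      have S: "submonoid (compl Q) T" using submonoid_compl D_Spec_Spec[OF Q] .
      show "?m Q = frc Q (a \<otimes>\<^bsub>T\<^esub> b) (f \<otimes>\<^bsub>T\<^esub> g)"
        "?p Q = frc Q (a \<otimes>\<^bsub>T\<^esub> g \<oplus>\<^bsub>T\<^esub> b \<otimes>\<^bsub>T\<^esub> f) (f \<otimes>\<^bsub>T\<^esub> g)"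
        using Q' a b D_compl by (simp_all add: loc_mult[OF S] loc_add[OF S])
    qed
    then show ?thesis using a b unfolding fg[symmetric]
      by (intro bexI[of _ "a \<otimes>\<^bsub>T\<^esub> b"] bexI[of _ "a \<otimes>\<^bsub>T\<^esub> g \<oplus>\<^bsub>T\<^esub> b \<otimes>\<^bsub>T\<^esub> f"] bexI[of _ "f \<otimes>\<^bsub>T\<^esub> g"])
        (auto simp: fg)
  qed
  show "?m \<in> secs U"
    by (rule secsI[OF restrict_extensional]) (use * in blast)
  show "?p \<in> secs U"
    by (rule secsI[OF restrict_extensional]) (use * in blast)
qed

lemma comm_semiring_sec_ring:
  assumes U: "openin (Spec_top \<Gamma> T u) U"
  shows "comm_semiring (sec_ring U)"
proof -
  have L: "comm_semiring (loc_prime P)" if "P \<in> U" for P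
    using comm_semiring_loc_prime open_Spec[OF U that] .
  note mon = comm_semiring.axioms(2)[OF L]
  note sem = comm_semiring.axioms(1)[OF L]
  note ab = semiring.axioms(1)[OF sem]
  note simps = abelian_monoid.a_assoc[OF ab] abelian_monoid.l_zero[OF ab]
    monoid.m_assoc[OF semiring.axioms(2)[OF sem]] monoid.l_one[OF semiring.axioms(2)[OF sem]]
    semiring.l_distr[OF sem] semiring.l_null[OF sem] secs_val
  note cl = secs_mult_add secs_one[OF U] secs_zero[OF U]
  show ?thesis
  proof (rule comm_semiringI)
    fix x y assume x: "x \<in> carrier (sec_ring U)" and y: "y \<in> carrier (sec_ring U)"
    show "x \<oplus>\<^bsub>sec_ring U\<^esub> y \<in> carrier (sec_ring U)" "x \<otimes>\<^bsub>sec_ring U\<^esub> y \<in> carrier (sec_ring U)"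
      using x y cl by simp_all
    show "x \<oplus>\<^bsub>sec_ring U\<^esub> y = y \<oplus>\<^bsub>sec_ring U\<^esub> x"
      using x y abelian_monoid.a_comm[OF ab] by (auto intro!: restrict_ext simp: secs_val)
    show "x \<otimes>\<^bsub>sec_ring U\<^esub> y = y \<otimes>\<^bsub>sec_ring U\<^esub> x"
      using x y comm_monoid.m_comm[OF mon] by (auto intro!: restrict_ext simp: secs_val)
  next
    fix x assume x: "x \<in> carrier (sec_ring U)"
    have xe: "restrict x U = x" using x by (simp add: extensional_restrict secs_ext)
    have "\<zero>\<^bsub>sec_ring U\<^esub> \<oplus>\<^bsub>sec_ring U\<^esub> x = restrict x U" "\<one>\<^bsub>sec_ring U\<^esub> \<otimes>\<^bsub>sec_ring U\<^esub> x = restrict x U"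
      using x by (auto intro!: restrict_ext simp: simps)
    then show "\<zero>\<^bsub>sec_ring U\<^esub> \<oplus>\<^bsub>sec_ring U\<^esub> x = x" "\<one>\<^bsub>sec_ring U\<^esub> \<otimes>\<^bsub>sec_ring U\<^esub> x = x"
      unfolding xe by auto
    show "\<zero>\<^bsub>sec_ring U\<^esub> \<otimes>\<^bsub>sec_ring U\<^esub> x = \<zero>\<^bsub>sec_ring U\<^esub>"
      using x by (auto intro!: restrict_ext simp: simps)
  next
    fix x y z assume c: "x \<in> carrier (sec_ring U)" "y \<in> carrier (sec_ring U)" "z \<in> carrier (sec_ring U)"
    show "x \<oplus>\<^bsub>sec_ring U\<^esub> y \<oplus>\<^bsub>sec_ring U\<^esub> z = x \<oplus>\<^bsub>sec_ring U\<^esub> (y \<oplus>\<^bsub>sec_ring U\<^esub> z)"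
      "x \<otimes>\<^bsub>sec_ring U\<^esub> y \<otimes>\<^bsub>sec_ring U\<^esub> z = x \<otimes>\<^bsub>sec_ring U\<^esub> (y \<otimes>\<^bsub>sec_ring U\<^esub> z)"
      "(x \<oplus>\<^bsub>sec_ring U\<^esub> y) \<otimes>\<^bsub>sec_ring U\<^esub> z = x \<otimes>\<^bsub>sec_ring U\<^esub> z \<oplus>\<^bsub>sec_ring U\<^esub> y \<otimes>\<^bsub>sec_ring U\<^esub> z"
      using c by (auto intro!: restrict_ext simp: simps)
  qed (use cl in simp_all)
qed

lemma secs_restrict:
  assumes s: "s \<in> secs U" and V: "openin (Spec_top \<Gamma> T u) V" "V \<subseteq> U"
  shows "restrict s V \<in> secs V"
proof (rule secsI)
  fix P assume P: "P \<in> V"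
  then have "P \<in> U" using V by blast
  obtain a f where a: "a \<in> carrier T" "f \<in> carrier T" "P \<in> D f" "D f \<subseteq> U"
      "\<forall>Q\<in>D f. s Q = frc Q a f" by (rule secsE[OF s \<open>P \<in> U\<close>])
  obtain g where g: "g \<in> carrier T" "P \<in> D g" "D g \<subseteq> V" by (rule D_Spec_basis[OF V(1) P])
  have fg: "D (f \<otimes>\<^bsub>T\<^esub> g) = D f \<inter> D g" using a g by (simp add: D_Spec_mult)
  have "restrict s V Q = frc Q (a \<otimes>\<^bsub>T\<^esub> g) (f \<otimes>\<^bsub>T\<^esub> g)" if Q: "Q \<in> D (f \<otimes>\<^bsub>T\<^esub> g)" for Q
  proof -
    have Q': "Q \<in> D f" "Q \<in> D g" "Q \<in> V" using Q g(3) unfolding fg by auto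
    then show ?thesis using a g D_compl frc_cancel[OF D_Spec_Spec[OF Q]] by simp
  qed
  then show "\<exists>a\<in>carrier T. \<exists>f\<in>carrier T. P \<in> D f \<and> D f \<subseteq> V \<and> (\<forall>Q\<in>D f. restrict s V Q = frc Q a f)"
    using a g by (intro bexI[of _ "a \<otimes>\<^bsub>T\<^esub> g"] bexI[of _ "f \<otimes>\<^bsub>T\<^esub> g"]) (auto simp: fg)
qed auto

definition res :: "'a set set \<Rightarrow> 'a set set \<Rightarrow> ('a set \<Rightarrow> ('a \<times> 'a) set) \<Rightarrow> 'a set \<Rightarrow> ('a \<times> 'a) set" where
  "res U V s = restrict s V"

lemma presheaf_sec_ring: "presheaf_semirings (Spec_top \<Gamma> T u) sec_ring res"
proof (rule presheaf_semirings.intro)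
  fix U assume U: "openin (Spec_top \<Gamma> T u) U"
  show "comm_semiring (sec_ring U)" by (rule comm_semiring_sec_ring[OF U])
  show "res U U s = s" if "s \<in> carrier (sec_ring U)" for s
    using that by (simp add: res_def extensional_restrict secs_ext)
next
  fix U V assume V: "openin (Spec_top \<Gamma> T u) V" and sub: "V \<subseteq> U"
  show "res U V \<in> semiring_hom (sec_ring U) (sec_ring V)"
    by (rule semiring_hom_memI)
      (use sub secs_restrict[OF _ V] in \<open>auto simp: res_def Int_absorb1 intro!: restrict_ext\<close>)
  show "res V W (res U V s) = res U W s" if "W \<subseteq> V" for W s
    using that by (simp add: res_def Int_absorb1)
qed

lemma sheaf_sec_ring: "sheaf_semirings (Spec_top \<Gamma> T u) sec_ring res"
proof -
  interpret presheaf_semirings "Spec_top \<Gamma> T u" sec_ring res by (rule presheaf_sec_ring)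
  show ?thesis
  proof (intro sheaf_semirings.intro sheaf_semirings_axioms.intro presheaf_sec_ring)
    fix \<U> s t
    assume s: "s \<in> carrier (sec_ring (\<Union>\<U>))" and t: "t \<in> carrier (sec_ring (\<Union>\<U>))"
      and eq: "\<And>V. V \<in> \<U> \<Longrightarrow> res (\<Union>\<U>) V s = res (\<Union>\<U>) V t"
    show "s = t"
    proof (rule secs_eqI)
      show "s \<in> secs (\<Union>\<U>)" "t \<in> secs (\<Union>\<U>)" using s t by auto
      fix P assume "P \<in> \<Union>\<U>"
      then obtain V where V: "V \<in> \<U>" "P \<in> V" by blast
      show "s P = t P" using fun_cong[OF eq[OF V(1)], of P] V(2) by (simp add: res_def)
    qed
  next
    fix \<U> and \<sigma> :: "'a set set \<Rightarrow> 'a set \<Rightarrow> ('a \<times> 'a) set"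
    assume op: "\<And>V. V \<in> \<U> \<Longrightarrow> openin (Spec_top \<Gamma> T u) V"
      and sg: "\<And>V. V \<in> \<U> \<Longrightarrow> \<sigma> V \<in> carrier (sec_ring V)"
      and eq: "\<And>V W. \<lbrakk>V \<in> \<U>; W \<in> \<U>\<rbrakk> \<Longrightarrow> res V (V \<inter> W) (\<sigma> V) = res W (V \<inter> W) (\<sigma> W)"
    define s where "s = (\<lambda>P\<in>\<Union>\<U>. \<sigma> (SOME V. V \<in> \<U> \<and> P \<in> V) P)"
    have sV: "s P = \<sigma> V P" if V: "V \<in> \<U>" "P \<in> V" for V P
    proof -
      have W: "(SOME V. V \<in> \<U> \<and> P \<in> V) \<in> \<U> \<and> P \<in> (SOME V. V \<in> \<U> \<and> P \<in> V)" (is "?W \<in> _ \<and> _")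
        using V by (rule_tac someI[of _ V]) blast
      have "\<sigma> V P = \<sigma> ?W P" using fun_cong[OF eq[of V ?W], of P] V W by (simp add: res_def)
      moreover have "P \<in> \<Union>\<U>" using V by blast
      ultimately show ?thesis by (simp add: s_def)
    qed
    have "s \<in> secs (\<Union>\<U>)"
    proof (rule secsI)
      show "s \<in> extensional (\<Union>\<U>)" by (simp add: s_def)
      fix P assume "P \<in> \<Union>\<U>"
      then obtain V where V: "V \<in> \<U>" "P \<in> V" by blast
      have sgV: "\<sigma> V \<in> secs V" using sg[OF V(1)] by simp
      obtain a f where a: "a \<in> carrier T" "f \<in> carrier T" "P \<in> D f" "D f \<subseteq> V"
        "\<forall>Q\<in>D f. \<sigma> V Q = frc Q a f" by (rule secsE[OF sgV V(2)]) 
      have "s Q = frc Q a f" if "Q \<in> D f" for Q using a(4,5) sV[OF V(1)] that by auto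
      moreover have "D f \<subseteq> \<Union>\<U>" using a(4) V(1) by blast
      ultimately show "\<exists>a\<in>carrier T. \<exists>f\<in>carrier T. P \<in> D f \<and> D f \<subseteq> \<Union>\<U> \<and> (\<forall>Q\<in>D f. s Q = frc Q a f)"
        using a by blast
    qed
    moreover have "res (\<Union>\<U>) V s = \<sigma> V" if V: "V \<in> \<U>" for V
    proof (rule secs_eqI)
      show sgV: "\<sigma> V \<in> secs V" using sg[OF V] by simp
      show "res (\<Union>\<U>) V s \<in> secs V"
        unfolding res_def using calculation V op[OF V] by (intro secs_restrict) auto
      fix P assume "P \<in> V"
      then show "res (\<Union>\<U>) V s P = \<sigma> V P" using sV[OF V] by (simp add: res_def)
    qed
    ultimately show "\<exists>s\<in>carrier (sec_ring (\<Union>\<U>)). \<forall>V\<in>\<U>. res (\<Union>\<U>) V s = \<sigma> V" by auto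
  qed
qed

definition frac_sec :: "'a \<Rightarrow> ('a \<times> 'a) set \<Rightarrow> 'a set \<Rightarrow> ('a \<times> 'a) set" where
  "frac_sec f x = (\<lambda>Q\<in>D f. relocate (compl Q) x)"

lemma frac_sec_fraction:
  assumes f: "f \<in> carrier T" and a: "a \<in> carrier T" "s \<in> powers T f"
  shows "frac_sec f (fraction T (powers T f) a s) = (\<lambda>Q\<in>D f. frc Q a s)"
  unfolding frac_sec_def
  by (intro restrict_ext relocate_frac submonoid_powers submonoid_compl powers_compl)
    (use f a D_Spec_Spec in auto)

lemma frac_sec_secs:
  assumes f: "f \<in> carrier T" and x: "x \<in> carrier (loc_at T f)"
  shows "frac_sec f x \<in> secs (D f)"
proof -
  obtain a s where a: "a \<in> carrier T" "s \<in> powers T f" "x = fraction T (powers T f) a s"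
    by (rule loc_carrierE[OF submonoid_powers[OF f] x])
  obtain n :: nat where n: "s = f [^]\<^bsub>T\<^esub> n" using a(2) by (auto simp: powers_def)
  have sf: "s \<otimes>\<^bsub>T\<^esub> f \<in> carrier T" using n f by simp
  have "D (f [^]\<^bsub>T\<^esub> n \<otimes>\<^bsub>T\<^esub> f) = D f"
    using f by (induction n) (auto simp: D_Spec_mult)
  then have D: "D (s \<otimes>\<^bsub>T\<^esub> f) = D f" by (simp add: n)
  show ?thesis
  proof (rule secsI)
    fix P assume P: "P \<in> D f"
    have "frac_sec f x Q = frc Q (a \<otimes>\<^bsub>T\<^esub> f) (s \<otimes>\<^bsub>T\<^esub> f)" if Q: "Q \<in> D f" for Q
      using Q f a powers_compl[OF Q f] D_compl[OF Q f] frc_cancel[OF D_Spec_Spec[OF Q], of a s f]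
      by (auto simp: frac_sec_fraction)
    then show "\<exists>a\<in>carrier T. \<exists>g\<in>carrier T. P \<in> D g \<and> D g \<subseteq> D f \<and> (\<forall>Q\<in>D g. frac_sec f x Q = frc Q a g)"
      using P a f sf D by (intro bexI[of _ "a \<otimes>\<^bsub>T\<^esub> f"] bexI[of _ "s \<otimes>\<^bsub>T\<^esub> f"]) auto
  qed (simp add: frac_sec_def)
qed

lemma frac_sec_hom:
  assumes f: "f \<in> carrier T"
  shows "frac_sec f \<in> semiring_hom (loc_at T f) (sec_ring (D f))"
proof -
  have h: "relocate (compl Q) \<in> semiring_hom (loc_at T f) (loc_prime Q)" if Q: "Q \<in> D f" for Q
    using f Q by (intro relocate_hom submonoid_powers submonoid_compl powers_compl D_Spec_Spec[OF Q])
  note H = semiring_homD[OF h]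
  show ?thesis
  proof (rule semiring_hom_memI)
    show "frac_sec f x \<in> carrier (sec_ring (D f))" if "x \<in> carrier (loc_at T f)" for x
      using frac_sec_secs[OF f that] by simp
  qed (auto simp: frac_sec_def H intro!: restrict_ext)
qed

lemma frac_sec_bij:
  assumes f: "f \<in> carrier T"
  shows "bij_betw (frac_sec f) (carrier (loc_at T f)) (carrier (sec_ring (D f)))"
  unfolding bij_betw_def
proof (rule conjI, rule inj_onI, rule_tac [2] subset_antisym, rule_tac [2] subsetI, rule_tac [3] subsetI)
  note p = submonoid_powers[OF f]
  fix x y assume x: "x \<in> carrier (loc_at T f)" and y: "y \<in> carrier (loc_at T f)"
    and e: "frac_sec f x = frac_sec f y"
  obtain a s where a: "a \<in> carrier T" "s \<in> powers T f" "x = fraction T (powers T f) a s"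
    by (rule loc_carrierE[OF p x])
  obtain b t where b: "b \<in> carrier T" "t \<in> powers T f" "y = fraction T (powers T f) b t"
    by (rule loc_carrierE[OF p y])
  have e': "(\<lambda>Q\<in>D f. frc Q a s) = (\<lambda>Q\<in>D f. frc Q b t)" using e a b f by (simp add: frac_sec_fraction)
  have "frc Q a s = frc Q b t" if "Q \<in> D f" for Q using fun_cong[OF e', of Q] that by simp
  then show "x = y" unfolding a(3) b(3) by (intro eq_on_D f a b)
next
  fix s assume "s \<in> frac_sec f ` carrier (loc_at T f)"
  then show "s \<in> carrier (sec_ring (D f))" using frac_sec_secs[OF f] by auto
next
  fix s assume "s \<in> carrier (sec_ring (D f))"
  then have s: "s \<in> secs (D f)" by simp
  obtain a t where a: "a \<in> carrier T" "t \<in> powers T f" "\<forall>Q\<in>D f. s Q = frc Q a t"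
    by (rule secs_D[OF f s])
  have x: "fraction T (powers T f) a t \<in> carrier (loc_at T f)"
    by (rule frac_carrier[OF submonoid_powers[OF f] a(1,2)])
  have "frac_sec f (fraction T (powers T f) a t) = s"
    by (rule secs_eqI[OF frac_sec_secs[OF f x] s]) (use a f in \<open>simp add: frac_sec_fraction\<close>)
  then show "s \<in> frac_sec f ` carrier (loc_at T f)" using x by blast
qed

lemma frac_sec_restriction:
  assumes f: "f \<in> carrier T" and g: "g \<in> carrier T" and sub: "D g \<subseteq> D f"
  shows "\<exists>r\<in>semiring_hom (loc_at T f) (loc_at T g).
    (\<forall>a\<in>carrier T. r (loc_map T f a) = loc_map T g a) \<and>
    (\<forall>x\<in>carrier (loc_at T f). res (D f) (D g) (frac_sec f x) = frac_sec g (r x))"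
proof -
  interpret presheaf_semirings "Spec_top \<Gamma> T u" sec_ring res by (rule presheaf_sec_ring)
  define k where "k x = res (D f) (D g) (frac_sec f x)" for x
  note RH = semiring_homD[OF res_hom[OF D_Spec_open[OF f] D_Spec_open[OF g] sub]]
  note TH = semiring_homD[OF frac_sec_hom[OF f]]
  note TG = semiring_homD[OF frac_sec_hom[OF g]]
  have kc: "k x \<in> carrier (sec_ring (D g))" if "x \<in> carrier (loc_at T f)" for x
    unfolding k_def using RH(1) TH(1) that by blast
  note bij = frac_sec_bij[OF g]
  define r where "r x = the_inv_into (carrier (loc_at T g)) (frac_sec g) (k x)" for x
  have rc: "r x \<in> carrier (loc_at T g)" and tr: "frac_sec g (r x) = k x"
    if x: "x \<in> carrier (loc_at T f)" for x
  proof -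
    show "r x \<in> carrier (loc_at T g)" unfolding r_def
      using bij kc[OF x] by (intro the_inv_into_into[OF _ _ order_refl]) (auto simp: bij_betw_def)
    show "frac_sec g (r x) = k x" unfolding r_def
      using bij kc[OF x] by (intro f_the_inv_into_f) (auto simp: bij_betw_def)
  qed
  have inj: "x = y" if "x \<in> carrier (loc_at T g)" "y \<in> carrier (loc_at T g)" "frac_sec g x = frac_sec g y" for x y
    using bij that by (auto simp: bij_betw_def dest: inj_onD)
  interpret F: comm_semiring "loc_at T f" by (rule comm_semiring_localization[OF submonoid_powers[OF f]])
  interpret G: comm_semiring "loc_at T g" by (rule comm_semiring_localization[OF submonoid_powers[OF g]])
  have "r \<in> semiring_hom (loc_at T f) (loc_at T g)"
  proof (rule semiring_hom_memI)
    fix x assume x: "x \<in> carrier (loc_at T f)"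
    then show "r x \<in> carrier (loc_at T g)" by (rule rc)
    fix y assume y: "y \<in> carrier (loc_at T f)"
    show "r (x \<otimes>\<^bsub>loc_at T f\<^esub> y) = r x \<otimes>\<^bsub>loc_at T g\<^esub> r y"
    proof (rule inj)
      have "frac_sec g (r (x \<otimes>\<^bsub>loc_at T f\<^esub> y)) = k x \<otimes>\<^bsub>sec_ring (D g)\<^esub> k y"
        unfolding tr[OF F.m_closed[OF x y]] k_def TH(2)[OF x y] by (rule RH(2)[OF TH(1)[OF x] TH(1)[OF y]])
      also have "\<dots> = frac_sec g (r x \<otimes>\<^bsub>loc_at T g\<^esub> r y)"
        unfolding TG(2)[OF rc[OF x] rc[OF y]] tr[OF x] tr[OF y] ..
      finally show "frac_sec g (r (x \<otimes>\<^bsub>loc_at T f\<^esub> y)) = frac_sec g (r x \<otimes>\<^bsub>loc_at T g\<^esub> r y)" .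
    qed (use x y rc in auto)
    show "r (x \<oplus>\<^bsub>loc_at T f\<^esub> y) = r x \<oplus>\<^bsub>loc_at T g\<^esub> r y"
    proof (rule inj)
      have "frac_sec g (r (x \<oplus>\<^bsub>loc_at T f\<^esub> y)) = k x \<oplus>\<^bsub>sec_ring (D g)\<^esub> k y"
        unfolding tr[OF F.a_closed[OF x y]] k_def TH(3)[OF x y] by (rule RH(3)[OF TH(1)[OF x] TH(1)[OF y]])
      also have "\<dots> = frac_sec g (r x \<oplus>\<^bsub>loc_at T g\<^esub> r y)"
        unfolding TG(3)[OF rc[OF x] rc[OF y]] tr[OF x] tr[OF y] ..
      finally show "frac_sec g (r (x \<oplus>\<^bsub>loc_at T f\<^esub> y)) = frac_sec g (r x \<oplus>\<^bsub>loc_at T g\<^esub> r y)" .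
    qed (use x y rc in auto)
  next
    show "r \<one>\<^bsub>loc_at T f\<^esub> = \<one>\<^bsub>loc_at T g\<^esub>"
      by (rule inj) (use rc tr in \<open>simp_all add: k_def TH(4) TG(4) RH(4) del: sec_ring_simps\<close>)
    show "r \<zero>\<^bsub>loc_at T f\<^esub> = \<zero>\<^bsub>loc_at T g\<^esub>"
      by (rule inj) (use rc tr in \<open>simp_all add: k_def TH(5) TG(5) RH(5) del: sec_ring_simps\<close>)
  qed
  moreover have "r (loc_map T f a) = loc_map T g a" if a: "a \<in> carrier T" for a
  proof -
    have c: "loc_map T f a \<in> carrier (loc_at T f)" "loc_map T g a \<in> carrier (loc_at T g)"
      unfolding loc_map_def
      using a f g by (auto intro!: frac_carrier submonoid_powers S_one)
    have "frac_sec g (r (loc_map T f a)) = frac_sec g (loc_map T g a)"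
      unfolding tr[OF c(1)] unfolding k_def loc_map_def using a f g sub
      by (simp add: frac_sec_fraction S_one[OF submonoid_powers] res_def Int_absorb1)
    then show ?thesis by (rule inj[OF rc[OF c(1)] c(2)])
  qed
  ultimately show ?thesis using tr unfolding k_def by metis
qed

theorem structure_sheaf_exists:
  "structure_sheaf \<Gamma> T u sec_ring res frac_sec"
proof -
  have "structure_sheaf_axioms \<Gamma> T u sec_ring res frac_sec"
    by (rule structure_sheaf_axioms.intro) (rule frac_sec_hom frac_sec_bij frac_sec_restriction; assumption)+
  then show ?thesis
    by (intro structure_sheaf.intro ternary_gamma_semiring_axioms sheaf_sec_ring)
qed

end

end

theory Submission
  imports Defs
begin

text \<open>
  The stalk is the filtered colimit of the semirings of sections over the open neighbourhoods
  of the point. Finitely many germs are always germs of sections over one common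
  neighbourhood \<open>U\<close> (\<open>germs_common_rep\<close>), and on germs of sections over one \<open>U\<close> the stalk
  operations are computed in the semiring of sections over \<open>U\<close> (\<open>germ_mult\<close>, \<open>germ_add\<close>).
  Hence every identity that holds in all the semirings of sections holds in the stalk, which
  is thus a commutative semiring, and taking germs is a semiring homomorphism.

  The canonical map from \<open>T\<close> to the stalk is the composite of \<open>T \<rightarrow> T\<^sub>1\<close>, the identification
  of \<open>T\<^sub>1\<close> with the global sections, and the passage to germs, so it is a semiring
  homomorphism. Semiring homomorphisms preserve units, so composing with \<open>u\<close> gives
  a homomorphism from \<open>\<Gamma>\<close> to the units of the stalk; by construction it consists of the
  germs of the unit sections (\<open>transport_unit_hom\<close>).

  Finally, the unit section over \<open>U\<close> is the restriction of the global one and so has the same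
  germ. The bracket formed in the stalk from these units is therefore the one computed on
  representatives, and as any three germs have representatives over a common
  neighbourhood, no other operation on the stalk is induced by the brackets on sections.
\<close>

section \<open>Stalks of presheaves of semirings\<close>

context presheaf_semirings
begin

abbreviation germ_at :: "'x \<Rightarrow> 'x set \<Rightarrow> 'b \<Rightarrow> ('x set \<times> 'b) set" where
  "germ_at \<equiv> germ X F \<rho>"

abbreviation stalk_at :: "'x \<Rightarrow> ('x set \<times> 'b) set ring" where
  "stalk_at \<equiv> stalk X F \<rho>"

lemma res_closed:
  "\<lbrakk>openin X U; openin X V; V \<subseteq> U; s \<in> carrier (F U)\<rbrakk> \<Longrightarrow> \<rho> U V s \<in> carrier (F V)"
  using semiring_homD(1)[OF res_hom] .

lemma germ_self:
  "\<lbrakk>openin X U; p \<in> U; s \<in> carrier (F U)\<rbrakk> \<Longrightarrow> (U, s) \<in> germ_at p U s"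
  unfolding germ_def by auto

text \<open>Agreement near \<open>p\<close> is an equivalence relation: two neighbourhoods of agreement are
  intersected for transitivity.\<close>

lemma germ_subset:
  assumes U: "openin X U" "s \<in> carrier (F U)"
    and V: "openin X V" "t \<in> carrier (F V)"
    and W: "openin X W" "p \<in> W" "W \<subseteq> U \<inter> V" "\<rho> U W s = \<rho> V W t"
  shows "germ_at p U s \<subseteq> germ_at p V t"
proof
  fix x assume "x \<in> germ_at p U s"
  then obtain U' s' W' where x: "x = (U', s')" "openin X U'" "p \<in> U'" "s' \<in> carrier (F U')"
    and W': "openin X W'" "p \<in> W'" "W' \<subseteq> U \<inter> U'" "\<rho> U W' s = \<rho> U' W' s'"
    by (auto simp: germ_def)
  let ?W = "W \<inter> W'"
  have o: "openin X ?W" using W W' by blast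
  have "\<rho> V ?W t = \<rho> W ?W (\<rho> V W t)" by (rule res_comp[symmetric]) (use o V W in auto)
  also have "\<dots> = \<rho> W ?W (\<rho> U W s)" using W by simp
  also have "\<dots> = \<rho> U ?W s" by (rule res_comp) (use o U W in auto)
  also have "\<dots> = \<rho> W' ?W (\<rho> U W' s)" by (rule res_comp[symmetric]) (use o U W' in auto)
  also have "\<dots> = \<rho> W' ?W (\<rho> U' W' s')" using W' by simp
  also have "\<dots> = \<rho> U' ?W s'" by (rule res_comp) (use o x W' in auto)
  finally have "\<rho> V ?W t = \<rho> U' ?W s'" .
  then show "x \<in> germ_at p V t" unfolding germ_def using x o W W' by auto
qed

lemma germ_eqI:
  assumes "openin X U" "s \<in> carrier (F U)" "openin X V" "t \<in> carrier (F V)"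
    and "openin X W" "p \<in> W" "W \<subseteq> U \<inter> V" "\<rho> U W s = \<rho> V W t"
  shows "germ_at p U s = germ_at p V t"
proof
  show "germ_at p U s \<subseteq> germ_at p V t" by (rule germ_subset[OF assms])
  show "germ_at p V t \<subseteq> germ_at p U s"
    by (rule germ_subset[OF assms(3,4,1,2,5,6)]) (use assms(7,8) in auto)
qed

lemma germ_restrict:
  assumes U: "openin X U" "s \<in> carrier (F U)" and V: "openin X V" "p \<in> V" "V \<subseteq> U"
  shows "germ_at p V (\<rho> U V s) = germ_at p U s"
proof (rule germ_eqI)
  show "openin X V" "openin X V" "openin X U" "s \<in> carrier (F U)" "p \<in> V" using assms by auto
  show "\<rho> U V s \<in> carrier (F V)" using assms by (intro res_closed)
  show "V \<subseteq> V \<inter> U" using V by blast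
  show "\<rho> V V (\<rho> U V s) = \<rho> U V s" using assms by (intro res_id res_closed)
qed

lemma germ_closed:
  "\<lbrakk>openin X U; p \<in> U; s \<in> carrier (F U)\<rbrakk> \<Longrightarrow> germ_at p U s \<in> carrier (stalk_at p)"
  by (auto simp: stalk_def)

lemma stalk_carrierE:
  assumes "x \<in> carrier (stalk_at p)"
  obtains U s where "openin X U" "p \<in> U" "s \<in> carrier (F U)" "x = germ_at p U s"
  using assms by (auto simp: stalk_def)

text \<open>The open neighbourhoods of \<open>p\<close> are directed, so three germs live over one of them;
  three is what the associative and distributive laws and the bracket require.\<close>

lemma germs_common_rep:
  assumes "x \<in> carrier (stalk_at p)" "y \<in> carrier (stalk_at p)" "z \<in> carrier (stalk_at p)"
  obtains U r s t where "openin X U" "p \<in> U"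
    "r \<in> carrier (F U)" "s \<in> carrier (F U)" "t \<in> carrier (F U)"
    "x = germ_at p U r" "y = germ_at p U s" "z = germ_at p U t"
proof -
  obtain A a where A: "openin X A" "p \<in> A" "a \<in> carrier (F A)" "x = germ_at p A a"
    by (rule stalk_carrierE[OF assms(1)])
  obtain B b where B: "openin X B" "p \<in> B" "b \<in> carrier (F B)" "y = germ_at p B b"
    by (rule stalk_carrierE[OF assms(2)])
  obtain C c where C: "openin X C" "p \<in> C" "c \<in> carrier (F C)" "z = germ_at p C c"
    by (rule stalk_carrierE[OF assms(3)])
  let ?U = "A \<inter> B \<inter> C"
  have U: "openin X ?U" "p \<in> ?U" "?U \<subseteq> A" "?U \<subseteq> B" "?U \<subseteq> C" using A B C by auto
  show thesis
  proof (rule that[OF U(1,2)])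
    show "\<rho> A ?U a \<in> carrier (F ?U)" "\<rho> B ?U b \<in> carrier (F ?U)" "\<rho> C ?U c \<in> carrier (F ?U)"
      using A B C U by (auto intro!: res_closed)
    show "x = germ_at p ?U (\<rho> A ?U a)" "y = germ_at p ?U (\<rho> B ?U b)" "z = germ_at p ?U (\<rho> C ?U c)"
      using A B C U by (simp_all add: germ_restrict)
  qed
qed

text \<open>This covers addition and multiplication alike: any binary operation on sections that
  commutes with restriction passes to germs. The union over all representatives then ranges
  over copies of a single germ.\<close>

lemma germ_operation:
  assumes cl: "\<And>U s t. \<lbrakk>openin X U; s \<in> carrier (F U); t \<in> carrier (F U)\<rbrakk> \<Longrightarrow> f U s t \<in> carrier (F U)"
    and res: "\<And>U V s t. \<lbrakk>openin X U; openin X V; V \<subseteq> U; s \<in> carrier (F U); t \<in> carrier (F U)\<rbrakk>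
      \<Longrightarrow> \<rho> U V (f U s t) = f V (\<rho> U V s) (\<rho> U V t)"
    and U: "openin X U" "p \<in> U" and s: "s \<in> carrier (F U)" and t: "t \<in> carrier (F U)"
  shows "(\<Union>(A, a)\<in>germ_at p U s. \<Union>(B, b)\<in>germ_at p U t.
      germ_at p (A \<inter> B) (f (A \<inter> B) (\<rho> A (A \<inter> B) a) (\<rho> B (A \<inter> B) b))) = germ_at p U (f U s t)"
proof -
  have eq: "germ_at p (A \<inter> B) (f (A \<inter> B) (\<rho> A (A \<inter> B) a) (\<rho> B (A \<inter> B) b)) = germ_at p U (f U s t)"
    if a: "(A, a) \<in> germ_at p U s" and b: "(B, b) \<in> germ_at p U t" for A a B b
  proof -
    obtain V where A: "openin X A" "a \<in> carrier (F A)"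
      and V: "openin X V" "p \<in> V" "V \<subseteq> U \<inter> A" "\<rho> U V s = \<rho> A V a"
      using a by (auto simp: germ_def)
    obtain W where B: "openin X B" "b \<in> carrier (F B)"
      and W: "openin X W" "p \<in> W" "W \<subseteq> U \<inter> B" "\<rho> U W t = \<rho> B W b"
      using b by (auto simp: germ_def)
    let ?N = "A \<inter> B" and ?M = "V \<inter> W"
    have o: "openin X ?N" "openin X ?M" using A B V W by auto
    have aN: "\<rho> A ?N a \<in> carrier (F ?N)" and bN: "\<rho> B ?N b \<in> carrier (F ?N)"
      using A B o by (auto intro!: res_closed)
    have "\<rho> ?N ?M (\<rho> A ?N a) = \<rho> A ?M a" by (rule res_comp) (use A o V W in auto)
    also have "\<dots> = \<rho> V ?M (\<rho> A V a)" by (rule res_comp[symmetric]) (use A o V in auto)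
    also have "\<dots> = \<rho> V ?M (\<rho> U V s)" using V by simp
    also have "\<dots> = \<rho> U ?M s" by (rule res_comp) (use U s o V in auto)
    finally have sM: "\<rho> ?N ?M (\<rho> A ?N a) = \<rho> U ?M s" .
    have "\<rho> ?N ?M (\<rho> B ?N b) = \<rho> B ?M b" by (rule res_comp) (use B o V W in auto)
    also have "\<dots> = \<rho> W ?M (\<rho> B W b)" by (rule res_comp[symmetric]) (use B o W in auto)
    also have "\<dots> = \<rho> W ?M (\<rho> U W t)" using W by simp
    also have "\<dots> = \<rho> U ?M t" by (rule res_comp) (use U t o W in auto)
    finally have tM: "\<rho> ?N ?M (\<rho> B ?N b) = \<rho> U ?M t" .
    have "\<rho> ?N ?M (f ?N (\<rho> A ?N a) (\<rho> B ?N b)) = f ?M (\<rho> ?N ?M (\<rho> A ?N a)) (\<rho> ?N ?M (\<rho> B ?N b))"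
      by (rule res) (use o aN bN V W in auto)
    also have "\<dots> = \<rho> U ?M (f U s t)"
      unfolding sM tM by (rule res[symmetric]) (use U s t o V in auto)
    finally have M: "\<rho> ?N ?M (f ?N (\<rho> A ?N a) (\<rho> B ?N b)) = \<rho> U ?M (f U s t)" .
    show ?thesis
      by (rule germ_eqI[OF o(1) cl[OF o(1) aN bN] U(1) cl[OF U(1) s t] o(2) _ _ M]) (use V W in auto)
  qed
  have "(\<Union>(B, b)\<in>germ_at p U t. germ_at p (A \<inter> B) (f (A \<inter> B) (\<rho> A (A \<inter> B) a) (\<rho> B (A \<inter> B) b))) =
      germ_at p U (f U s t)" if "(A, a) \<in> germ_at p U s" for A a
    using germ_self[OF U t] by (intro SUP_eq_const) (auto simp only: eq[OF that] split_paired_all prod.case)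
  then show ?thesis
    using germ_self[OF U s] by (intro SUP_eq_const) (auto simp only: split_paired_all prod.case)
qed

lemma germ_mult:
  assumes "openin X U" "p \<in> U" "s \<in> carrier (F U)" "t \<in> carrier (F U)"
  shows "germ_at p U s \<otimes>\<^bsub>stalk_at p\<^esub> germ_at p U t = germ_at p U (s \<otimes>\<^bsub>F U\<^esub> t)"
proof -
  have "s \<otimes>\<^bsub>F V\<^esub> t \<in> carrier (F V)" if "openin X V" "s \<in> carrier (F V)" "t \<in> carrier (F V)" for V s t
  proof -
    interpret comm_semiring "F V" by (rule sections_semiring[OF that(1)])
    show ?thesis using that by simp
  qed
  then show ?thesis
    using germ_operation[where f = "\<lambda>U s t. s \<otimes>\<^bsub>F U\<^esub> t", OF _ _ assms] semiring_homD(2)[OF res_hom]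
    by (simp add: stalk_def)
qed

lemma germ_add:
  assumes "openin X U" "p \<in> U" "s \<in> carrier (F U)" "t \<in> carrier (F U)"
  shows "germ_at p U s \<oplus>\<^bsub>stalk_at p\<^esub> germ_at p U t = germ_at p U (s \<oplus>\<^bsub>F U\<^esub> t)"
proof -
  have "s \<oplus>\<^bsub>F V\<^esub> t \<in> carrier (F V)" if "openin X V" "s \<in> carrier (F V)" "t \<in> carrier (F V)" for V s t
  proof -
    interpret comm_semiring "F V" by (rule sections_semiring[OF that(1)])
    show ?thesis using that by simp
  qed
  then show ?thesis
    using germ_operation[where f = "\<lambda>U s t. s \<oplus>\<^bsub>F U\<^esub> t", OF _ _ assms] semiring_homD(3)[OF res_hom]
    by (simp add: stalk_def)
qed

text \<open>The constants of the stalk are germs of global constants, and restriction to \<open>U\<close>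
  preserves constants.\<close>

lemma germ_one_zero:
  assumes U: "openin X U" "p \<in> U"
  shows "germ_at p U \<one>\<^bsub>F U\<^esub> = \<one>\<^bsub>stalk_at p\<^esub>" "germ_at p U \<zero>\<^bsub>F U\<^esub> = \<zero>\<^bsub>stalk_at p\<^esub>"
proof -
  have sub: "U \<subseteq> topspace X" using U(1) by (rule openin_subset)
  interpret comm_semiring "F (topspace X)" by (rule sections_semiring) simp
  note h = semiring_homD(4,5)[OF res_hom[OF openin_topspace U(1) sub]]
  show "germ_at p U \<one>\<^bsub>F U\<^esub> = \<one>\<^bsub>stalk_at p\<^esub>" "germ_at p U \<zero>\<^bsub>F U\<^esub> = \<zero>\<^bsub>stalk_at p\<^esub>"
    using germ_restrict[OF openin_topspace one_closed U sub]
      germ_restrict[OF openin_topspace zero_closed U sub] h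
    by (simp_all add: stalk_def)
qed

lemma germ_hom:
  assumes "openin X U" "p \<in> U"
  shows "germ_at p U \<in> semiring_hom (F U) (stalk_at p)"
  by (rule semiring_hom_memI) (simp_all add: assms germ_closed germ_mult germ_add germ_one_zero)

text \<open>Each law involves at most three germs and is inherited from the sections over a
  common neighbourhood of representatives.\<close>

lemma comm_semiring_stalk:
  assumes p: "p \<in> topspace X"
  shows "comm_semiring (stalk_at p)"
proof -
  have laws: "x \<oplus>\<^bsub>stalk_at p\<^esub> y \<in> carrier (stalk_at p) \<and> x \<otimes>\<^bsub>stalk_at p\<^esub> y \<in> carrier (stalk_at p) \<and>
      (x \<oplus>\<^bsub>stalk_at p\<^esub> y) \<oplus>\<^bsub>stalk_at p\<^esub> z = x \<oplus>\<^bsub>stalk_at p\<^esub> (y \<oplus>\<^bsub>stalk_at p\<^esub> z) \<and>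
      x \<oplus>\<^bsub>stalk_at p\<^esub> y = y \<oplus>\<^bsub>stalk_at p\<^esub> x \<and>
      \<zero>\<^bsub>stalk_at p\<^esub> \<oplus>\<^bsub>stalk_at p\<^esub> x = x \<and>
      (x \<otimes>\<^bsub>stalk_at p\<^esub> y) \<otimes>\<^bsub>stalk_at p\<^esub> z = x \<otimes>\<^bsub>stalk_at p\<^esub> (y \<otimes>\<^bsub>stalk_at p\<^esub> z) \<and>
      x \<otimes>\<^bsub>stalk_at p\<^esub> y = y \<otimes>\<^bsub>stalk_at p\<^esub> x \<and>
      \<one>\<^bsub>stalk_at p\<^esub> \<otimes>\<^bsub>stalk_at p\<^esub> x = x \<and>
      (x \<oplus>\<^bsub>stalk_at p\<^esub> y) \<otimes>\<^bsub>stalk_at p\<^esub> z =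
        x \<otimes>\<^bsub>stalk_at p\<^esub> z \<oplus>\<^bsub>stalk_at p\<^esub> y \<otimes>\<^bsub>stalk_at p\<^esub> z \<and>
      \<zero>\<^bsub>stalk_at p\<^esub> \<otimes>\<^bsub>stalk_at p\<^esub> x = \<zero>\<^bsub>stalk_at p\<^esub>"
    if c: "x \<in> carrier (stalk_at p)" "y \<in> carrier (stalk_at p)" "z \<in> carrier (stalk_at p)" for x y z
  proof -
    obtain U r s t where U: "openin X U" "p \<in> U"
      and e: "r \<in> carrier (F U)" "s \<in> carrier (F U)" "t \<in> carrier (F U)"
      "x = germ_at p U r" "y = germ_at p U s" "z = germ_at p U t"
      by (rule germs_common_rep[OF c])
    interpret comm_semiring "F U" by (rule sections_semiring[OF U(1)])
    show ?thesis
      using e by (simp add: germ_mult[OF U] germ_add[OF U] germ_closed[OF U] germ_one_zero[OF U, symmetric]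
        a_ac m_ac l_distr r_distr)
  qed
  interpret comm_semiring "F (topspace X)" by (rule sections_semiring) simp
  show ?thesis
  proof (rule comm_semiringI)
    show "\<zero>\<^bsub>stalk_at p\<^esub> \<in> carrier (stalk_at p)" "\<one>\<^bsub>stalk_at p\<^esub> \<in> carrier (stalk_at p)"
      using germ_closed[OF openin_topspace p]
      by (simp_all add: germ_one_zero[OF openin_topspace p, symmetric])
  qed (use laws in \<open>simp only:\<close>)+
qed

text \<open>The inheritance condition fixes the value on every triple of germs over a common
  neighbourhood, and every triple is of this kind.\<close>

lemma inherited_bracket_unique:
  assumes B: "B \<in> carrier (stalk_at p) \<times> carrier (stalk_at p) \<times> carrier (stalk_at p) \<rightarrow>\<^sub>E Y"
      "inherits_bracket X F \<rho> p w \<gamma> B"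
    and C: "C \<in> carrier (stalk_at p) \<times> carrier (stalk_at p) \<times> carrier (stalk_at p) \<rightarrow>\<^sub>E Z"
      "inherits_bracket X F \<rho> p w \<gamma> C"
  shows "B = C"
proof (rule extensionalityI)
  fix q assume "q \<in> carrier (stalk_at p) \<times> carrier (stalk_at p) \<times> carrier (stalk_at p)"
  then obtain x y z where q: "q = (x, y, z)"
    and c: "x \<in> carrier (stalk_at p)" "y \<in> carrier (stalk_at p)" "z \<in> carrier (stalk_at p)" by auto
  obtain U r s t where "openin X U" "p \<in> U"
    "r \<in> carrier (F U)" "s \<in> carrier (F U)" "t \<in> carrier (F U)"
    "x = germ_at p U r" "y = germ_at p U s" "z = germ_at p U t"
    by (rule germs_common_rep[OF c])
  then show "B q = C q" using B(2) C(2) unfolding inherits_bracket_def q by simp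
qed (use B(1) C(1) in \<open>auto simp: PiE_def\<close>)

end

section \<open>Transport along semiring homomorphisms\<close>

lemma semiring_hom_comp:
  "\<lbrakk>g \<in> semiring_hom R S; h \<in> semiring_hom S Q\<rbrakk> \<Longrightarrow> (\<lambda>x. h (g x)) \<in> semiring_hom R Q"
  by (rule semiring_hom_memI) (simp_all add: semiring_homD[of g R S] semiring_homD[of h S Q])

context ternary_gamma_semiring
begin

text \<open>The image of the inverse of a unit is an inverse of its image.\<close>

lemma transport_unit_hom:
  assumes S: "comm_semiring S" and h: "h \<in> semiring_hom T S"
  shows "ternary_gamma_semiring \<Gamma> S (\<lambda>\<gamma>. h (u \<gamma>))"
proof -
  interpret S: comm_semiring S by (rule S)
  note H = semiring_homD[OF h]
  have unit: "h x \<in> Units S" if x: "x \<in> Units T" for x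
  proof -
    have c: "x \<in> carrier T" "inv\<^bsub>T\<^esub> x \<in> carrier T" using x by auto
    then have "h (inv\<^bsub>T\<^esub> x) \<otimes>\<^bsub>S\<^esub> h x = \<one>\<^bsub>S\<^esub>" "h x \<otimes>\<^bsub>S\<^esub> h (inv\<^bsub>T\<^esub> x) = \<one>\<^bsub>S\<^esub>"
      using H(2)[OF c] H(2)[OF c(2,1)] H(4) Units_l_inv[OF x] Units_r_inv[OF x] by simp_all
    then show ?thesis unfolding Units_def using H(1) c by blast
  qed
  have "(\<lambda>\<gamma>. h (u \<gamma>)) \<in> hom \<Gamma> (units_of S)"
    using u_hom unit H(2) u_closed by (auto simp: hom_def units_of_def Pi_iff)
  then show ?thesis
    by (intro ternary_gamma_semiring.intro ternary_gamma_semiring_axioms.intro S \<Gamma>.comm_group_axioms)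
qed

end

lemma (in comm_semiring) loc_map_hom:
  assumes f: "f \<in> carrier R"
  shows "loc_map R f \<in> semiring_hom R (loc_at R f)"
proof -
  note S = submonoid_powers[OF f]
  show ?thesis
    by (rule semiring_hom_memI)
      (simp_all add: loc_map_def frac_carrier[OF S] loc_mult[OF S] loc_add[OF S] S_one[OF S]
        loc_one[OF S] loc_zero[OF S])
qed

section \<open>The stalk of the structure sheaf\<close>

context structure_sheaf
begin

lemma can_section_hom:
  assumes U: "openin (Spec_top \<Gamma> T u) U"
  shows "can_section \<Gamma> T u \<rho> \<theta> U \<in> semiring_hom T (F U)"
proof -
  have sub: "U \<subseteq> D_Spec \<Gamma> T u \<one>\<^bsub>T\<^esub>" using openin_subset[OF U] by (simp add: D_Spec_one topspace_Spec)
  have "(\<lambda>a. \<rho> (D_Spec \<Gamma> T u \<one>\<^bsub>T\<^esub>) U (\<theta> \<one>\<^bsub>T\<^esub> (loc_map T \<one>\<^bsub>T\<^esub> a))) \<in> semiring_hom T (F U)"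
    by (rule semiring_hom_comp[OF semiring_hom_comp[OF loc_map_hom theta_hom] res_hom])
      (auto intro: D_Spec_open U sub[THEN subsetD])
  then show ?thesis by (simp add: can_section_def[abs_def])
qed

text \<open>Canonical sections restrict to canonical sections, so their germs can be taken over any
  neighbourhood of \<open>P\<close> instead of the whole spectrum.\<close>

lemma germ_can_section:
  assumes U: "openin (Spec_top \<Gamma> T u) U" and P: "P \<in> U" and a: "a \<in> carrier T"
  shows "germ_at P U (can_section \<Gamma> T u \<rho> \<theta> U a) = stalk_map \<Gamma> T u F \<rho> \<theta> P a"
proof -
  let ?X = "Spec_top \<Gamma> T u" and ?c = "can_section \<Gamma> T u \<rho> \<theta>"
  have oS: "openin ?X (Spec \<Gamma> T u)" using openin_topspace[of ?X] by (simp add: topspace_Spec)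
  have sub: "U \<subseteq> Spec \<Gamma> T u" using openin_subset[OF U] by (simp add: topspace_Spec)
  have c: "\<theta> \<one>\<^bsub>T\<^esub> (loc_map T \<one>\<^bsub>T\<^esub> a) \<in> carrier (F (Spec \<Gamma> T u))"
    using semiring_homD(1)[OF theta_hom[OF one_closed] semiring_homD(1)[OF loc_map_hom[OF one_closed] a]]
    by (simp add: D_Spec_one)
  have "?c U a = \<rho> (Spec \<Gamma> T u) U (?c (Spec \<Gamma> T u) a)"
    unfolding can_section_def D_Spec_one by (rule res_comp[OF oS oS U sub order_refl c, symmetric])
  then show ?thesis
    unfolding stalk_map_def
    using germ_restrict[OF oS semiring_homD(1)[OF can_section_hom[OF oS] a] U P sub] by simp
qed

lemma stalk_unit_eq: "stalk_unit \<Gamma> T u F \<rho> \<theta> P \<gamma> = stalk_map \<Gamma> T u F \<rho> \<theta> P (u \<gamma>)"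
  by (simp add: stalk_unit_def unit_section_def stalk_map_def)

context
  fixes P assumes P: "P \<in> Spec \<Gamma> T u"
begin

lemma stalk_map_semiring_hom: "stalk_map \<Gamma> T u F \<rho> \<theta> P \<in> semiring_hom T (stalk_at P)"
proof -
  have oS: "openin (Spec_top \<Gamma> T u) (Spec \<Gamma> T u)"
    using openin_topspace[of "Spec_top \<Gamma> T u"] by (simp add: topspace_Spec)
  show ?thesis
    unfolding stalk_map_def[abs_def] by (rule semiring_hom_comp[OF can_section_hom[OF oS] germ_hom[OF oS P]])
qed

lemma ternary_gamma_semiring_stalk:
  "ternary_gamma_semiring \<Gamma> (stalk_at P) (stalk_unit \<Gamma> T u F \<rho> \<theta> P)"
proof -
  have "comm_semiring (stalk_at P)" using P by (intro comm_semiring_stalk) (simp add: topspace_Spec)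
  from transport_unit_hom[OF this stalk_map_semiring_hom] show ?thesis
    by (simp add: stalk_unit_eq[abs_def])
qed

lemma stalk_map_ternary_hom:
  "stalk_map \<Gamma> T u F \<rho> \<theta> P \<in> ternary_hom \<Gamma> T u (stalk_at P) (stalk_unit \<Gamma> T u F \<rho> \<theta> P)"
  using stalk_map_semiring_hom by (simp add: ternary_hom_def stalk_unit_eq)

text \<open>The unit of the stalk is represented over the given \<open>U\<close> by the unit section of \<open>U\<close>,
  so the bracket is a product of four germs over \<open>U\<close>.\<close>

lemma stalk_bracket_inherited:
  assumes \<gamma>: "\<gamma> \<in> carrier \<Gamma>"
  shows "inherits_bracket (Spec_top \<Gamma> T u) F \<rho> P (unit_section \<Gamma> T u \<rho> \<theta>) \<gamma>
    (\<lambda>(x, y, z). tbracket (stalk_at P) (stalk_unit \<Gamma> T u F \<rho> \<theta> P) \<gamma> x y z)"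
  unfolding inherits_bracket_def
proof (intro allI impI, elim conjE)
  fix U r s t
  assume U: "openin (Spec_top \<Gamma> T u) U" "P \<in> U"
    and c: "r \<in> carrier (F U)" "s \<in> carrier (F U)" "t \<in> carrier (F U)"
  interpret U: comm_semiring "F U" by (rule sections_semiring[OF U(1)])
  let ?w = "unit_section \<Gamma> T u \<rho> \<theta> U"
  have w: "?w \<gamma> \<in> carrier (F U)"
    unfolding unit_section_def by (rule semiring_homD(1)[OF can_section_hom[OF U(1)] u_closed[OF \<gamma>]])
  have "stalk_unit \<Gamma> T u F \<rho> \<theta> P \<gamma> = germ_at P U (?w \<gamma>)"
    unfolding stalk_unit_eq unit_section_def by (rule germ_can_section[OF U u_closed[OF \<gamma>], symmetric])
  then show "(case (germ_at P U r, germ_at P U s, germ_at P U t) of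
      (x, y, z) \<Rightarrow> tbracket (stalk_at P) (stalk_unit \<Gamma> T u F \<rho> \<theta> P) \<gamma> x y z) =
      germ_at P U (tbracket (F U) ?w \<gamma> r s t)"
    using c w by (simp add: tbracket_def germ_mult[OF U])
qed

lemma ex1_inherited_bracket:
  assumes \<gamma>: "\<gamma> \<in> carrier \<Gamma>"
  shows "\<exists>!B. B \<in> carrier (stalk_at P) \<times> carrier (stalk_at P) \<times> carrier (stalk_at P) \<rightarrow>\<^sub>E carrier (stalk_at P) \<and>
    inherits_bracket (Spec_top \<Gamma> T u) F \<rho> P (unit_section \<Gamma> T u \<rho> \<theta>) \<gamma> B"
proof -
  let ?A = "carrier (stalk_at P) \<times> carrier (stalk_at P) \<times> carrier (stalk_at P)"
  interpret S: ternary_gamma_semiring \<Gamma> "stalk_at P" "stalk_unit \<Gamma> T u F \<rho> \<theta> P"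
    by (rule ternary_gamma_semiring_stalk)
  define B where "B = restrict (\<lambda>(x, y, z). tbracket (stalk_at P) (stalk_unit \<Gamma> T u F \<rho> \<theta> P) \<gamma> x y z) ?A"
  have "B \<in> ?A \<rightarrow>\<^sub>E carrier (stalk_at P)"
    using S.u_closed[OF \<gamma>] by (auto simp: B_def tbracket_def)
  moreover have "inherits_bracket (Spec_top \<Gamma> T u) F \<rho> P (unit_section \<Gamma> T u \<rho> \<theta>) \<gamma> B"
    using stalk_bracket_inherited[OF \<gamma>] unfolding inherits_bracket_def B_def by (simp add: germ_closed)
  ultimately show ?thesis by (intro ex1I[of _ B]) (auto intro: inherited_bracket_unique)
qed

end

end

theorem theorem6:
  fixes \<Gamma> :: "('g, 'k) monoid_scheme"
    and T :: "('a, 'm) ring_scheme"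
    and u :: "'g \<Rightarrow> 'a"
    and F :: "'a set set \<Rightarrow> ('b, 'n) ring_scheme"
    and \<rho> :: "'a set set \<Rightarrow> 'a set set \<Rightarrow> 'b \<Rightarrow> 'b"
    and \<theta> :: "'a \<Rightarrow> ('a \<times> 'a) set \<Rightarrow> 'b"
    and P :: "'a set"
  assumes "ternary_gamma_semiring \<Gamma> T u"
    and "structure_sheaf \<Gamma> T u F \<rho> \<theta>"
    and "P \<in> Spec \<Gamma> T u"
  shows "let X = Spec_top \<Gamma> T u;
             \<O>\<^sub>P = stalk X F \<rho> P;
             v = stalk_unit \<Gamma> T u F \<rho> \<theta> P
    in ternary_gamma_semiring \<Gamma> \<O>\<^sub>P v \<and>
       (\<forall>\<gamma>\<in>carrier \<Gamma>.
          (\<exists>!B. B \<in> carrier \<O>\<^sub>P \<times> carrier \<O>\<^sub>P \<times> carrier \<O>\<^sub>P \<rightarrow>\<^sub>E carrier \<O>\<^sub>P \<and>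
                inherits_bracket X F \<rho> P (unit_section \<Gamma> T u \<rho> \<theta>) \<gamma> B) \<and>
          inherits_bracket X F \<rho> P (unit_section \<Gamma> T u \<rho> \<theta>) \<gamma>
            (\<lambda>(x, y, z). tbracket \<O>\<^sub>P v \<gamma> x y z)) \<and>
       stalk_map \<Gamma> T u F \<rho> \<theta> P \<in> ternary_hom \<Gamma> T u \<O>\<^sub>P v"
proof -
  interpret structure_sheaf \<Gamma> T u F \<rho> \<theta> by (rule assms(2))
  show ?thesis
    unfolding Let_def
    by (intro conjI ballI ternary_gamma_semiring_stalk[OF assms(3)] ex1_inherited_bracket[OF assms(3)]
        stalk_bracket_inherited[OF assms(3)] stalk_map_ternary_hom[OF assms(3)])
qed

end
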